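(* Let $\mathcal{X}=(a,b)$ with $a,b\in\overline{\mathbb{R}}=\mathbb{R}\cup\{-\infty,\infty\}$, $a<b$. Let $\Theta\subseteq\mathbb{R}^d$ be open and let $\{P_\vartheta:\vartheta\in\Theta\}\subset\mathcal{W}_2(\mathcal{X})$ be a parametric family of probability measures that are absolutely continuous with respect to Lebesgue measure on $\mathbb{R}$, with densities $p_\vartheta$ such that for any $\vartheta\in\Theta$, $p_\vartheta(x)>0$ for $x\in\mathcal{X}$ and $p_\vartheta(x)=0$ for $x\notin\mathcal{X}$. Let $F_\vartheta(x)=\int_{-\infty}^xp_\vartheta(y)\,\mathrm{d}y$, and let $T_t^\vartheta$ denote the optimal transport map from $P_t$ to $P_\vartheta$. Fix $t_0\in\Theta$ and assume: (i) the map $\vartheta\mapsto p_\vartheta(x)$ is differentiable for any $x\in\mathcal{X}$, $\vartheta\in\Theta$, and there exists $\delta>0$ such that $\int_{\mathcal{X}}\sup_{v\in B_\delta(t_0)}\bigl|\frac{\partial}{\partial v_i}p_v(x)\bigr|\,\mathrm{d}x<\infty$ for all $i\in\{1,\dots,d\}$; (ii) the map $\vartheta\mapsto F_\vartheta(x)$ is twice differentiable for any $x\in\mathcal{X}$, $\vartheta\in\Theta$, and for any $\vartheta\in\Theta$ there exists $\eta>0$ such that $$\int_{\mathcal{X}}\sup_{v\in B_\eta(t_0)}\Bigl|\bigl(T_v^\vartheta(x)-x\bigr)\frac{\partial^2}{\partial v_i\partial v_j}F_v(x)+\Bigl(\frac{\partial}{\partial v_i}T_v^\vartheta(x)\Bigr)\Bigl(\frac{\partial}{\partial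 v_j}F_v(x)\Bigr)\Bigr|\,\mathrm{d}x<\infty$$ for all $i,j\in\{1,\dots,d\}$; (iii) for any $\vartheta\in\Theta$ and $x_0\in\mathcal{X}$, $$\lim_{x\to a}\nabla_tF_t(x)\big|_{t=t_0}\int_{x_0}^x\bigl(y-T_{t_0}^\vartheta(y)\bigr)\,\mathrm{d}y=0,\qquad\lim_{x\to b}\nabla_tF_t(x)\big|_{t=t_0}\int_{x_0}^x\bigl(y-T_{t_0}^\vartheta(y)\bigr)\,\mathrm{d}y=0.$$ If the mapping $t\mapsto W_2^2(P_t,P_\vartheta)$ is differentiable for any $\vartheta\in\Theta$, with the derivative $$\nabla_tW_2^2(P_t,P_\vartheta)\big|_{t=t_0}=\int_{\mathcal{X}}\phi_{t_0}^\vartheta(x)\,\nabla_tp_t(x)\big|_{t=t_0}\,\mathrm{d}x$$ for any $\phi_{t_0}^\vartheta\in\Phi(t_0,\vartheta)$, then the second derivative at $t_0$ exists and $$\nabla_t^2W_2^2(P_t,P_\vartheta)\big|_{t=t_0}=2\Biggl(\int_{\mathcal{X}}\bigl(T_{t_0}^\vartheta(x)-x\bigr)\nabla_t^2F_t(x)\big|_{t=t_0}\,\mathrm{d}x+\int_{\mathcal{X}}\Bigl(\frac{\partial}{\partial x}T_{t_0}^\vartheta(x)\Bigr)\frac{\nabla_tF_t(x)\big|_{t=t_0}\bigl(\nabla_tF_t(x)\big|_{t=t_0}\bigr)^\top}{p_{t_0}(x)}\,\mathrm{d}x\Biggr).$$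
   Context: $\mathcal{W}_2(\mathcal{X})$ is the set of probability measures on $\mathcal{X}$ with finite second moment, and $W_2^2(P,Q)=\inf_\pi\int|x-y|^2\,\mathrm{d}\pi(x,y)$, the infimum over all couplings $\pi$ of $P$ and $Q$. Optimal transport maps are with respect to the cost $|x-y|^2$; here $T_t^\vartheta=F_\vartheta^{-1}\circ F_t$ with $F_\vartheta^{-1}(u)=\inf\{x:F_\vartheta(x)\ge u\}$. For $t\in\Theta$, $\delta>0$: $B_\delta(t)=\{\vartheta\in\Theta:\|t-\vartheta\|\le\delta\}$. $\nabla_t$ and $\nabla_t^2$ denote gradient and Hessian in $t$. For $t,\vartheta\in\Theta$, $$\Phi(t,\vartheta)=\Bigl\{\phi\in L^1(P_t):W_2^2(P_t,P_\vartheta)=\int_{\mathcal{X}}\phi\,\mathrm{d}P_t+\int_{\mathcal{X}}\phi^c\,\mathrm{d}P_\vartheta\Bigr\},\qquad\phi^c(y)=\inf_{x\in\mathcal{X}}\bigl(|x-y|^2-\phi(x)\bigr).$$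
   Formalization: The two integrals on the right need not exist separately under (i)–(iii); the formal theorem gives the Hessian as twice the integral of the sum of the two integrands, and the displayed sum of two integrals whenever at least one of them exists. *)

theory Defs
  imports "HOL-Probability.Probability"
begin

text \<open>Squared 2-Wasserstein distance of two probability measures on the real line. The infimum is
  taken in \<^typ>\<open>ennreal\<close>; it is finite whenever both second moments are.\<close>

definition couplings :: "real measure \<Rightarrow> real measure \<Rightarrow> (real \<times> real) measure set" where
  "couplings P Q =
     {\<pi>. sets \<pi> = sets (P \<Otimes>\<^sub>M Q) \<and> distr \<pi> P fst = P \<and> distr \<pi> Q snd = Q}"

definition W2_sq :: "real measure \<Rightarrow> real measure \<Rightarrow> real" where
  "W2_sq P Q = enn2real (INF \<pi>\<in>couplings P Q. \<integral>\<^sup>+ (x, y). ennreal (\<bar>x - y\<bar>\<^sup>2) \<partial>\<pi>)"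

text \<open>The transform may take the value \<open>-\<infinity>\<close>, hence the type \<^typ>\<open>ereal\<close>.\<close>

definition c_transform :: "real set \<Rightarrow> (real \<Rightarrow> real) \<Rightarrow> real \<Rightarrow> ereal" where
  "c_transform X \<phi> y = (INF x\<in>X. ereal (\<bar>x - y\<bar>\<^sup>2 - \<phi> x))"

text \<open>Since the transform is bounded above by a \<open>Q\<close>-integrable function, its integral is finite
  exactly when it is finite almost everywhere and integrable.\<close>

definition potentials ::
  "real set \<Rightarrow> real measure \<Rightarrow> real measure \<Rightarrow> (real \<Rightarrow> real) set" where
  "potentials X P Q =
     {\<phi>. integrable P \<phi> \<and>
         (AE y in Q. \<bar>c_transform X \<phi> y\<bar> \<noteq> \<infinity>) \<and>
         integrable Q (\<lambda>y. real_of_ereal (c_transform X \<phi> y)) \<and>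
         W2_sq P Q = (\<integral>x. \<phi> x \<partial>P) + (\<integral>y. real_of_ereal (c_transform X \<phi> y) \<partial>Q)}"

definition quantile :: "(real \<Rightarrow> real) \<Rightarrow> real \<Rightarrow> real" where
  "quantile F u = Inf {x. F x \<ge> u}"

text \<open>\<open>partial i f v\<close> is the derivative of \<open>f\<close> at \<open>v\<close> along the \<open>i\<close>-th coordinate; it is a
  meaningful number only if \<open>has_partial i f v\<close>.\<close>

definition has_partial :: "'d \<Rightarrow> (real^'d::finite \<Rightarrow> real) \<Rightarrow> real^'d \<Rightarrow> bool" where
  "has_partial i f v \<longleftrightarrow> (\<lambda>s. f (v + s *\<^sub>R axis i 1)) differentiable (at 0)"

definition partial :: "'d \<Rightarrow> (real^'d::finite \<Rightarrow> real) \<Rightarrow> real^'d \<Rightarrow> real" where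
  "partial i f v = deriv (\<lambda>s. f (v + s *\<^sub>R axis i 1)) 0"

definition grad :: "(real^'d::finite \<Rightarrow> real) \<Rightarrow> real^'d \<Rightarrow> real^'d" where
  "grad f v = (\<chi> i. partial i f v)"

definition hess :: "(real^'d::finite \<Rightarrow> real) \<Rightarrow> real^'d \<Rightarrow> real^'d^'d" where
  "hess f v = (\<chi> i j. partial i (partial j f) v)"

definition has_hessian ::
  "(real^'d::finite \<Rightarrow> real) \<Rightarrow> real^'d^'d \<Rightarrow> real^'d \<Rightarrow> bool" where
  "has_hessian f H t \<longleftrightarrow>
     (\<forall>\<^sub>F s in nhds t. f differentiable (at s)) \<and>
     (grad f has_derivative (\<lambda>h. H *v h)) (at t)"

definition twice_differentiable_at :: "(real^'d::finite \<Rightarrow> real) \<Rightarrow> real^'d \<Rightarrow> bool" where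
  "twice_differentiable_at f t \<longleftrightarrow> (\<exists>H. has_hessian f H t)"

definition outer :: "real^'d::finite \<Rightarrow> real^'d^'d" where
  "outer g = (\<chi> i j. g $ i * g $ j)"

end

theory Submission
  imports Defs
begin

text \<open>
  On the line the monotone coupling is optimal, so \<open>W\<^sub>2\<^sup>2(P\<^sub>v, P\<^sub>\<theta>)\<close> is the integral over \<open>u \<in> (0, 1)\<close> of the squared
  difference of the quantile functions \<open>q\<^sub>v\<close> and \<open>q = q\<^sub>\<theta>\<close>. Subtracting two such integrals and applying Fubini gives
  \<open>W\<^sub>2\<^sup>2(P\<^sub>v, P\<^sub>\<theta>) - W\<^sub>2\<^sup>2(P\<^sub>w, P\<^sub>\<theta>) = \<integral> (H\<^sub>x(F\<^sub>v(x)) - H\<^sub>x(F\<^sub>w(x))) dx\<close>, where \<open>H\<^sub>x' = 2 (q - x)\<close>; the integrand is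
  absolutely integrable because the quantile functions are square integrable.
  Hence \<open>\<partial>\<^sub>j W\<^sub>2\<^sup>2 = 2 \<integral> g\<^sub>j(v, x) dx\<close> with \<open>g\<^sub>j(v, x) = (T\<^sub>v(x) - x) \<partial>\<^sub>j F\<^sub>v(x)\<close>, for all \<open>v\<close> near \<open>t\<^sub>0\<close>: the domination
  of \<open>\<partial>\<^sub>i g\<^sub>j\<close> in (ii) controls the difference quotients. A second differentiation under the integral gives the
  Hessian. For this \<open>g\<^sub>j(\<cdot>, x)\<close> has to be totally differentiable at \<open>t\<^sub>0\<close> for almost every \<open>x\<close>, although only
  partial derivatives of \<open>T\<close> are assumed. If \<open>\<partial>\<^sub>j F(x) \<noteq> 0\<close>, the partial derivative of \<open>T\<close> forces \<open>q\<close> to be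
  differentiable at \<open>F(x)\<close>; if \<open>\<partial>\<^sub>j F(x) = 0\<close>, continuity of \<open>q\<close> suffices. In both cases the derivative of \<open>T\<close> in
  \<open>x\<close> enters through Lebesgue's differentiation theorem \<open>F' = p\<close> almost everywhere.
\<close>

section \<open>Differentiation and integration\<close>

lemma set_integral_atMost_diff:
  fixes f :: "real \<Rightarrow> real"
  assumes f: "integrable lborel f" and "c \<le> d"
  shows "(LBINT y:{..d}. f y) - (LBINT y:{..c}. f y) = integral {c..d} f"
proof -
  have [measurable]: "f \<in> borel_measurable borel"
    using borel_measurable_integrable[OF f] by simp
  have si: "set_integrable lborel A f" if "A \<in> sets borel" for A
    using f that by (intro set_integrable_subset[of lborel UNIV f A]) (auto simp: set_integrable_def)
  have "(LBINT y:{..d}. f y) = (LBINT y:{..c}. f y) + (LBINT y:{c<..d}. f y)"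
    using \<open>c \<le> d\<close> by (subst set_integral_Un[symmetric]) (auto intro!: si simp: ivl_disj_un)
  also have "(LBINT y:{c<..d}. f y) = (LBINT y:{c..d}. f y)"
    using AE_lborel_singleton[of c]
    by (intro set_integral_cong_set) (auto simp: set_borel_measurable_def elim!: eventually_mono)
  finally show ?thesis
    using set_borel_integral_eq_integral(2)[OF si[of "{c..d}"]] by simp
qed

text \<open>\<open>integrable_ccontinuous_explicit\<close> controls averages over intervals to the
  right of a point only. Applying it also to the reflected function controls the averages to the
  left, and outside two null sets both one-sided derivatives equal \<open>f x\<close>.\<close>

lemma AE_DERIV_indefinite_integral:
  fixes f :: "real \<Rightarrow> real"
  assumes f: "integrable lborel f"
  shows "AE x in lborel. ((\<lambda>x. LBINT y:{..x}. f y) has_real_derivative f x) (at x)"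
proof -
  define \<Phi> where "\<Phi> = (\<lambda>x. LBINT y:{..x}. f y)"
  have HK: "f integrable_on {c..d}" for c d
    by (rule integrable_on_subinterval[OF integrable_on_lborel[OF f]]) simp
  have \<Phi>_diff: "\<Phi> d - \<Phi> c = integral {c..d} f" if "c \<le> d" for c d
    unfolding \<Phi>_def using f that by (rule set_integral_atMost_diff)
  have 1: "\<And>c d. f integrable_on cbox c d" by (simp add: HK)
  obtain N1 where N1: "negligible N1"
    "\<And>x e. \<lbrakk>x \<notin> N1; 0 < e\<rbrakk> \<Longrightarrow>
               \<exists>d>0. \<forall>h. 0 < h \<and> h < d \<longrightarrow> norm (integral (cbox x (x + h *\<^sub>R One)) f /\<^sub>R h ^ DIM(real) - f x) < e"
    using integrable_ccontinuous_explicit[of f] 1 by metis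
  \<comment> \<open>The reflection turns averages to the left of \<open>x\<close> into averages to
    the right of \<open>- x\<close>.\<close>
  have 2: "\<And>c d. (\<lambda>x. f (- x)) integrable_on cbox c d"
    using HK Henstock_Kurzweil_Integration.integrable_reflect_real[where f = f]
    by (metis cbox_interval minus_minus)
  obtain N2 where N2: "negligible N2"
    "\<And>x e. \<lbrakk>x \<notin> N2; 0 < e\<rbrakk> \<Longrightarrow>
               \<exists>d>0. \<forall>h. 0 < h \<and> h < d \<longrightarrow> norm (integral (cbox x (x + h *\<^sub>R One)) (\<lambda>x. f (- x)) /\<^sub>R h ^ DIM(real) - f (- x)) < e"
    using integrable_ccontinuous_explicit[of "\<lambda>x. f (- x)"] 2 by metis
  have refl: "integral {- x..- x + h} (\<lambda>y. f (- y)) = integral {x - h..x} f" for x h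
    using Henstock_Kurzweil_Integration.integral_reflect_real[of x "x - h" f] by simp
  \<comment> \<open>The exceptional points of the reflected function have to be reflected
    back.\<close>
  have "negligible (uminus ` N2)"
    by (rule negligible_differentiable_image_negligible[OF order_refl N2(1)]) (auto intro!: derivative_intros)
  then have "N1 \<union> uminus ` N2 \<in> null_sets lebesgue"
    using N1(1) by (simp add: negligible_iff_null_sets[symmetric])
  then have "AE x in lebesgue. x \<notin> N1 \<union> uminus ` N2"
    by (rule AE_not_in)
  then have "AE x in lborel. x \<notin> N1 \<union> uminus ` N2"
    by (simp add: AE_completion_iff)
  then have "AE x in lborel. (\<Phi> has_real_derivative f x) (at x)"
  proof (rule AE_mp, intro AE_I2 impI)
    fix x assume x: "x \<notin> N1 \<union> uminus ` N2"
    then have x1: "x \<notin> N1" and x2: "- x \<notin> N2"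
      by (auto simp: image_iff)
    show "(\<Phi> has_real_derivative f x) (at x)"
      unfolding DERIV_def
    proof (rule LIM_I)
      fix e :: real assume e: "0 < e"
      obtain d1 where d1: "d1 > 0" "\<And>h. 0 < h \<Longrightarrow> h < d1 \<Longrightarrow> norm (integral {x..x + h} f / h - f x) < e"
        using N1(2)[OF x1 e] by (auto simp: divide_inverse mult.commute)
      obtain d2 where d2: "d2 > 0" "\<And>h. 0 < h \<Longrightarrow> h < d2 \<Longrightarrow> norm (integral {x - h..x} f / h - f x) < e"
        using N2(2)[OF x2 e] refl by (auto simp: divide_inverse mult.commute)
      show "\<exists>s>0. \<forall>h. h \<noteq> 0 \<and> norm (h - 0) < s \<longrightarrow> norm ((\<Phi> (x + h) - \<Phi> x) / h - f x) < e"
      proof (intro exI[of _ "min d1 d2"] conjI allI impI)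
        fix h :: real assume h: "h \<noteq> 0 \<and> norm (h - 0) < min d1 d2"
        show "norm ((\<Phi> (x + h) - \<Phi> x) / h - f x) < e"
        proof (cases "h > 0")
          case True
          then show ?thesis using d1(2)[of h] h \<Phi>_diff[of x "x + h"] by simp
        next
          case False
          then have "(\<Phi> (x + h) - \<Phi> x) / h = integral {x - (- h)..x} f / (- h)"
            using h \<Phi>_diff[of "x + h" x] by (simp add: field_simps)
          then show ?thesis using d2(2)[of "- h"] h False by simp
        qed
      qed (use d1 d2 in auto)
    qed
  qed
  then show ?thesis by (simp add: \<Phi>_def)
qed

section \<open>Partial derivatives and symmetry of the Hessian\<close>

lemma has_derivative_imp_DERIV_axis:
  fixes f :: "real^'d::finite \<Rightarrow> real"
  assumes "(f has_derivative D) (at (v + s *\<^sub>R axis i 1))"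
  shows "((\<lambda>s. f (v + s *\<^sub>R axis i 1)) has_real_derivative D (axis i 1)) (at s)"
proof -
  have "((\<lambda>s. v + s *\<^sub>R axis i 1) has_derivative (\<lambda>s. s *\<^sub>R axis i 1)) (at s)"
    by (auto intro!: derivative_eq_intros)
  from has_derivative_compose[OF this assms]
  have "((\<lambda>s. f (v + s *\<^sub>R axis i 1)) has_derivative (\<lambda>s. D (s *\<^sub>R axis i 1))) (at s)" .
  moreover have "(\<lambda>s. D (s *\<^sub>R axis i 1)) = (*) (D (axis i 1))"
    using linear_cmul[OF has_derivative_linear[OF assms]] by (auto simp: mult.commute)
  ultimately show ?thesis by (simp add: has_field_derivative_def)
qed

lemma partial_eqI:
  fixes f :: "real^'d::finite \<Rightarrow> real"
  assumes "(f has_derivative D) (at v)"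
  shows "partial i f v = D (axis i 1)"
  unfolding partial_def using has_derivative_imp_DERIV_axis[of f D v 0 i] assms by (auto intro: DERIV_imp_deriv)

text \<open>Moves the derivative from parameter 0 to parameter \<open>s\<close> of one fixed line,
  the form in which the mean value theorem uses it.\<close>

lemma has_partial_DERIV:
  fixes f :: "real^'d::finite \<Rightarrow> real"
  assumes "has_partial i f (v + s *\<^sub>R axis i 1)"
  shows "((\<lambda>s. f (v + s *\<^sub>R axis i 1)) has_real_derivative partial i f (v + s *\<^sub>R axis i 1)) (at s)"
proof -
  have "((\<lambda>h. f (v + s *\<^sub>R axis i 1 + h *\<^sub>R axis i 1)) has_real_derivative partial i f (v + s *\<^sub>R axis i 1)) (at 0)"
    using assms unfolding has_partial_def partial_def by (simp add: DERIV_deriv_iff_real_differentiable)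
  then have "((\<lambda>h. f (v + (h + s) *\<^sub>R axis i 1)) has_real_derivative partial i f (v + s *\<^sub>R axis i 1)) (at 0)"
    by (simp add: algebra_simps)
  then show ?thesis
    using DERIV_at_within_shift[of "\<lambda>s. f (v + s *\<^sub>R axis i 1)" _ s 0 UNIV] by (simp add: add.commute)
qed

lemma differentiable_imp_has_partial:
  fixes f :: "real^'d::finite \<Rightarrow> real"
  assumes "f differentiable (at v)"
  shows "has_partial i f v"
proof -
  obtain D where "(f has_derivative D) (at (v + 0 *\<^sub>R axis i 1))"
    using assms by (auto simp: differentiable_def)
  from has_derivative_imp_DERIV_axis[OF this] show ?thesis
    unfolding has_partial_def using real_differentiable_def by blast
qed

lemma has_hessian_imp_has_derivative_partial:
  fixes f :: "real^'d::finite \<Rightarrow> real"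
  assumes "has_hessian f H t"
  shows "(partial i f has_derivative (\<lambda>h. (H *v h) $ i)) (at t)"
proof -
  have "((\<lambda>v. grad f v $ i) has_derivative (\<lambda>h. (H *v h) $ i)) (at t)"
    using assms unfolding has_hessian_def
    by (auto intro: bounded_linear.has_derivative[OF bounded_linear_vec_nth])
  then show ?thesis by (simp add: grad_def)
qed

text \<open>The mean value theorem in direction \<open>i\<close> turns the second difference into a
  difference of two values of \<open>partial i f\<close>. Both points are close to \<open>t\<close>,
  so the linear approximation of \<open>partial i f\<close> at \<open>t\<close> evaluates it;
  continuity of second derivatives is not assumed.\<close>

lemma second_difference_has_hessian:
  fixes f :: "real^'d::finite \<Rightarrow> real"
  assumes H: "has_hessian f H t" and e: "e > 0"
  shows "\<exists>d>0. \<forall>s. 0 < s \<and> s < d \<longrightarrow>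
    \<bar>f (t + s *\<^sub>R axis i 1 + s *\<^sub>R axis j 1) - f (t + s *\<^sub>R axis i 1) - f (t + s *\<^sub>R axis j 1) + f t - s\<^sup>2 * H $ i $ j\<bar>
      \<le> e * s\<^sup>2"
proof -
  let ?a = "axis i (1::real) :: real^'d" and ?b = "axis j (1::real) :: real^'d"
  have "\<forall>\<^sub>F s in nhds t. f differentiable (at s)"
    using H by (simp add: has_hessian_def)
  then obtain d1 where d1: "d1 > 0" "\<And>v. dist v t < d1 \<Longrightarrow> f differentiable (at v)"
    unfolding eventually_nhds_metric by blast
  have "(partial i f has_derivative (\<lambda>h. (H *v h) $ i)) (at t)"
    by (rule has_hessian_imp_has_derivative_partial[OF H])
  then obtain d2 where d2: "d2 > 0" "\<And>v. norm (v - t) < d2 \<Longrightarrow>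
      norm (partial i f v - partial i f t - (H *v (v - t)) $ i) \<le> e / 3 * norm (v - t)"
    unfolding has_derivative_at_alt using e by (metis divide_pos_pos zero_less_numeral)
  show ?thesis
  \<comment> \<open>The halving is there because the far corner has distance up to
    \<open>2 * s\<close> from \<open>t\<close>.\<close>
  proof (intro exI[of _ "min d1 d2 / 2"] conjI allI impI)
    show "min d1 d2 / 2 > 0" using d1 d2 by simp
    fix s assume s: "0 < s \<and> s < min d1 d2 / 2"
    have nrm: "norm (r *\<^sub>R ?a + s *\<^sub>R ?b) \<le> 2 * s" "norm (r *\<^sub>R ?a) \<le> s" if "0 \<le> r" "r \<le> s" for r
      using that norm_triangle_ineq[of "r *\<^sub>R ?a" "s *\<^sub>R ?b"] by simp_all
    define \<phi> where "\<phi> = (\<lambda>r. f ((t + s *\<^sub>R ?b) + r *\<^sub>R ?a) - f (t + r *\<^sub>R ?a))"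
    have D: "(\<phi> has_real_derivative (partial i f ((t + s *\<^sub>R ?b) + r *\<^sub>R ?a) - partial i f (t + r *\<^sub>R ?a))) (at r)"
      if "0 \<le> r" "r \<le> s" for r
      unfolding \<phi>_def
      using nrm[OF that] s
      by (intro DERIV_diff has_partial_DERIV differentiable_imp_has_partial d1(2))
         (auto simp: dist_norm add_ac)
    obtain \<xi> where \<xi>: "0 < \<xi>" "\<xi> < s"
      "\<phi> s - \<phi> 0 = (s - 0) * (partial i f ((t + s *\<^sub>R ?b) + \<xi> *\<^sub>R ?a) - partial i f (t + \<xi> *\<^sub>R ?a))"
      using MVT2[of 0 s \<phi> "\<lambda>r. partial i f ((t + s *\<^sub>R ?b) + r *\<^sub>R ?a) - partial i f (t + r *\<^sub>R ?a)"] D s by auto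
    \<comment> \<open>Remainder of the linear approximation at \<open>t\<close>. The two evaluation
      points have distance at most \<open>2 * s\<close> and \<open>s\<close>, which with the factor
      \<open>e / 3\<close> adds up to \<open>e * s\<close>.\<close>
    define E where "E = (\<lambda>v. partial i f v - partial i f t - (H *v (v - t)) $ i)"
    have n1: "norm (E (t + (\<xi> *\<^sub>R ?a + s *\<^sub>R ?b))) \<le> e / 3 * (2 * s)"
    proof -
      have "norm (E (t + (\<xi> *\<^sub>R ?a + s *\<^sub>R ?b))) \<le> e / 3 * norm (\<xi> *\<^sub>R ?a + s *\<^sub>R ?b)"
        unfolding E_def using d2(2)[of "t + (\<xi> *\<^sub>R ?a + s *\<^sub>R ?b)"] nrm[of \<xi>] \<xi> s by auto
      also have "\<dots> \<le> e / 3 * (2 * s)"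
        using nrm[of \<xi>] \<xi> e by (intro mult_left_mono) auto
      finally show ?thesis .
    qed
    have n2: "norm (E (t + \<xi> *\<^sub>R ?a)) \<le> e / 3 * s"
    proof -
      have "norm (E (t + \<xi> *\<^sub>R ?a)) \<le> e / 3 * norm (\<xi> *\<^sub>R ?a)"
        unfolding E_def using d2(2)[of "t + \<xi> *\<^sub>R ?a"] nrm[of \<xi>] \<xi> s by auto
      also have "\<dots> \<le> e / 3 * s"
        using nrm(2)[of \<xi>] \<xi> e by (intro mult_left_mono) auto
      finally show ?thesis .
    qed
    have "(H *v (\<xi> *\<^sub>R ?a + s *\<^sub>R ?b)) $ i - (H *v (\<xi> *\<^sub>R ?a)) $ i = s * H $ i $ j"
      by (simp add: matrix_vector_right_distrib matrix_vector_mult_scaleR matrix_vector_mult_basis column_def)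
    then have "partial i f ((t + s *\<^sub>R ?b) + \<xi> *\<^sub>R ?a) - partial i f (t + \<xi> *\<^sub>R ?a) - s * H $ i $ j =
        E (t + (\<xi> *\<^sub>R ?a + s *\<^sub>R ?b)) - E (t + \<xi> *\<^sub>R ?a)"
      by (simp add: E_def add_ac)
    then have "norm (partial i f ((t + s *\<^sub>R ?b) + \<xi> *\<^sub>R ?a) - partial i f (t + \<xi> *\<^sub>R ?a) - s * H $ i $ j) \<le> e * s"
      using n1 n2 by simp
    then have "s * norm (partial i f ((t + s *\<^sub>R ?b) + \<xi> *\<^sub>R ?a) - partial i f (t + \<xi> *\<^sub>R ?a) - s * H $ i $ j) \<le> s * (e * s)"
      using s by (intro mult_left_mono) auto
    moreover have "s * norm (partial i f ((t + s *\<^sub>R ?b) + \<xi> *\<^sub>R ?a) - partial i f (t + \<xi> *\<^sub>R ?a) - s * H $ i $ j)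
       = \<bar>\<phi> s - \<phi> 0 - s\<^sup>2 * H $ i $ j\<bar>"
      using s unfolding \<xi>(3) by (simp add: abs_mult_pos' algebra_simps power2_eq_square)
    ultimately show "\<bar>f (t + s *\<^sub>R ?a + s *\<^sub>R ?b) - f (t + s *\<^sub>R ?a) - f (t + s *\<^sub>R ?b) + f t - s\<^sup>2 * H $ i $ j\<bar> \<le> e * s\<^sup>2"
      by (simp add: \<phi>_def algebra_simps power2_eq_square)
  qed
qed

text \<open>The second difference is symmetric in the two directions, and divided by
  \<open>s\<^sup>2\<close> it approaches both entries.\<close>

lemma has_hessian_symmetric:
  fixes f :: "real^'d::finite \<Rightarrow> real"
  assumes H: "has_hessian f H t"
  shows "H $ i $ j = H $ j $ i"
proof (rule ccontr)
  assume neq: "H $ i $ j \<noteq> H $ j $ i"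
  define e where "e = \<bar>H $ i $ j - H $ j $ i\<bar> / 4"
  have e: "e > 0" using neq by (simp add: e_def)
  let ?\<Delta> = "\<lambda>s i j. f (t + s *\<^sub>R axis i 1 + s *\<^sub>R axis j 1) - f (t + s *\<^sub>R axis i 1) - f (t + s *\<^sub>R axis j 1) + f t"
  obtain d1 where d1: "d1 > 0" "\<And>s. 0 < s \<Longrightarrow> s < d1 \<Longrightarrow> \<bar>?\<Delta> s i j - s\<^sup>2 * H $ i $ j\<bar> \<le> e * s\<^sup>2"
    using second_difference_has_hessian[OF H e, of i j] by blast
  obtain d2 where d2: "d2 > 0" "\<And>s. 0 < s \<Longrightarrow> s < d2 \<Longrightarrow> \<bar>?\<Delta> s j i - s\<^sup>2 * H $ j $ i\<bar> \<le> e * s\<^sup>2"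
    using second_difference_has_hessian[OF H e, of j i] by blast
  define s where "s = min d1 d2 / 2"
  have s: "0 < s" "s < d1" "s < d2" using d1(1) d2(1) by (auto simp: s_def)
  have "?\<Delta> s i j = ?\<Delta> s j i" by (simp add: add_ac)
  then have "\<bar>s\<^sup>2 * H $ i $ j - s\<^sup>2 * H $ j $ i\<bar> \<le> 2 * e * s\<^sup>2"
    using d1(2)[OF s(1,2)] d2(2)[OF s(1,3)] by linarith
  also have "\<bar>s\<^sup>2 * H $ i $ j - s\<^sup>2 * H $ j $ i\<bar> = \<bar>H $ i $ j - H $ j $ i\<bar> * s\<^sup>2"
    by (simp add: abs_mult flip: right_diff_distrib)
  finally have "\<bar>H $ i $ j - H $ j $ i\<bar> \<le> 2 * e" using s by simp
  then have "4 * e \<le> 2 * e" by (simp add: e_def)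
  then show False using e by simp
qed

text \<open>The derivative of \<open>grad f\<close> has the derivative of \<open>partial j f\<close>
  in row \<open>j\<close>, while \<open>hess\<close> stores \<open>partial i (partial j f)\<close>
  in row \<open>i\<close>. The two conventions are transposes of each other, and symmetry reconciles
  them.\<close>

lemma has_hessian_imp_hess_eq:
  fixes f :: "real^'d::finite \<Rightarrow> real"
  assumes H: "has_hessian f H t"
  shows "hess f t = H"
proof -
  have "partial i (partial j f) t = H $ i $ j" for i j
    using partial_eqI[OF has_hessian_imp_has_derivative_partial[OF H, of j], of i] has_hessian_symmetric[OF H]
    by (simp add: matrix_vector_mult_basis column_def)
  then show ?thesis by (simp add: hess_def vec_eq_iff)
qed

section \<open>Domination and differentiation under the integral sign\<close>

text \<open>The path from \<open>t\<close> to \<open>v\<close> changes one coordinate at a time, so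
  Lipschitz bounds along the axes suffice.\<close>

lemma abs_diff_le_coordinatewise:
  fixes f :: "real^'d::finite \<Rightarrow> real"
  assumes v: "v \<in> ball t r"
    and lip: "\<And>i w s. w \<in> ball t r \<Longrightarrow> w + s *\<^sub>R axis i 1 \<in> ball t r \<Longrightarrow> \<bar>f (w + s *\<^sub>R axis i 1) - f w\<bar> \<le> \<bar>s\<bar> * m i"
    and m: "\<And>i. m i \<ge> 0"
  shows "\<bar>f v - f t\<bar> \<le> norm (v - t) * (\<Sum>i\<in>UNIV. m i)"
proof -
  \<comment> \<open>The intermediate points take the coordinates in \<open>S\<close> from
    \<open>v\<close> and the others from \<open>t\<close>. They stay in the ball because no
    coordinate moves further from \<open>t\<close> than in \<open>v\<close>.\<close>
  define w where "w = (\<lambda>S. \<chi> i. if i \<in> S then v $ i else t $ i)"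
  have w_ball: "w S \<in> ball t r" for S
  proof -
    have "norm (w S - t) \<le> norm (v - t)"
      by (rule norm_le_componentwise_cart) (auto simp: w_def)
    then show ?thesis using v by (simp add: dist_norm norm_minus_commute)
  qed
  have "\<bar>f (w S) - f t\<bar> \<le> norm (v - t) * (\<Sum>i\<in>S. m i)" for S
  proof (induction S rule: finite_induct[OF finite])
    case 1
    have "w {} = t" by (simp add: w_def vec_eq_iff)
    then show ?case by simp
  next
    case (2 i S)
    have eq: "w (insert i S) = w S + (v $ i - t $ i) *\<^sub>R axis i 1"
      using 2 by (auto simp: w_def vec_eq_iff axis_def)
    have "\<bar>f (w (insert i S)) - f (w S)\<bar> \<le> \<bar>v $ i - t $ i\<bar> * m i"
      unfolding eq using w_ball[of "insert i S"] by (intro lip w_ball) (simp add: eq)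
    also have "\<dots> \<le> norm (v - t) * m i"
      using component_le_norm_cart[of "v - t" i] m by (intro mult_right_mono) auto
    finally show ?case using 2 by (simp add: algebra_simps)
  qed
  from this[of UNIV] show ?thesis by (simp add: w_def)
qed


text \<open>The supremum in \<open>fin\<close> need not be measurable. By the mean value theorem it dominates all difference
  quotients, and their supremum over a countable dense set is measurable.\<close>

lemma obtain_integrable_lipschitz_constant:
  fixes f f' :: "'a::euclidean_space \<Rightarrow> real \<Rightarrow> real" and e :: 'a
  assumes X [measurable]: "X \<in> sets borel" and "convex V"
    and cont: "\<And>x. x \<in> X \<Longrightarrow> continuous_on V (\<lambda>v. f v x)"
    and meas: "\<And>v. v \<in> V \<Longrightarrow> (\<lambda>x. indicator X x * f v x) \<in> borel_measurable borel"
    and deriv: "\<And>v s x. x \<in> X \<Longrightarrow> v + s *\<^sub>R e \<in> V \<Longrightarrow>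
      ((\<lambda>s. f (v + s *\<^sub>R e) x) has_real_derivative f' (v + s *\<^sub>R e) x) (at s)"
    and fin: "(\<integral>\<^sup>+x\<in>X. (SUP v\<in>V. ennreal \<bar>f' v x\<bar>) \<partial>lborel) < \<infinity>"
  obtains M where "integrable lborel M" "\<And>x. 0 \<le> M x"
    "AE x in lborel. x \<in> X \<longrightarrow> (\<forall>v s. v \<in> V \<longrightarrow> v + s *\<^sub>R e \<in> V \<longrightarrow> \<bar>f (v + s *\<^sub>R e) x - f v x\<bar> \<le> \<bar>s\<bar> * M x)"
proof -
  \<comment> \<open>Pairs with \<open>s = 0\<close> are left out, which makes the difference
    quotient continuous on \<open>C\<close>.\<close>
  define C where "C = {(v, s). v \<in> V \<and> v + s *\<^sub>R e \<in> V \<and> s \<noteq> 0}"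
  obtain C' where C': "countable C'" "C' \<subseteq> C" "C \<subseteq> closure C'"
    using separable[of C] by blast
  define Q where "Q = (\<lambda>x (v, s). (f (v + s *\<^sub>R e) x - f v x) / s)"
  define R where "R = (\<lambda>x. SUP z\<in>C'. ennreal (indicator X x * \<bar>Q x z\<bar>))"
  have Q_le: "ennreal \<bar>Q x z\<bar> \<le> (SUP v\<in>V. ennreal \<bar>f' v x\<bar>)" if "x \<in> X" "z \<in> C" for x z
  proof -
    obtain v s where z: "z = (v, s)" "v \<in> V" "v + s *\<^sub>R e \<in> V" "s \<noteq> 0"
      using \<open>z \<in> C\<close> by (auto simp: C_def)
    \<comment> \<open>Convexity of \<open>V\<close> keeps the intermediate point of the mean value
      theorem inside the range of the supremum.\<close>
    have seg: "v + r *\<^sub>R e \<in> V" if "r \<in> closed_segment 0 s" for r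
    proof -
      obtain u where u: "0 \<le> u" "u \<le> 1" "r = u * s"
        using \<open>r \<in> closed_segment 0 s\<close> by (auto simp: in_segment)
      have "(1 - u) *\<^sub>R v + u *\<^sub>R (v + s *\<^sub>R e) \<in> V"
        using convexD_alt[OF \<open>convex V\<close> z(2,3)] u by auto
      then show ?thesis using u by (simp add: algebra_simps)
    qed
    have D: "((\<lambda>s. f (v + s *\<^sub>R e) x) has_real_derivative f' (v + r *\<^sub>R e) x) (at r)"
      if "r \<in> closed_segment 0 s" for r
      by (rule deriv[OF \<open>x \<in> X\<close> seg[OF that]])
    obtain \<xi> where \<xi>: "\<xi> \<in> closed_segment 0 s" "Q x z = f' (v + \<xi> *\<^sub>R e) x"
    proof (cases "s > 0")
      case True
      with MVT2[of 0 s "\<lambda>s. f (v + s *\<^sub>R e) x" "\<lambda>r. f' (v + r *\<^sub>R e) x"] D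
      obtain \<xi> where "0 < \<xi>" "\<xi> < s" "f (v + s *\<^sub>R e) x - f (v + 0 *\<^sub>R e) x = (s - 0) * f' (v + \<xi> *\<^sub>R e) x"
        by (auto simp: closed_segment_eq_real_ivl)
      then show ?thesis using that[of \<xi>] z by (auto simp: Q_def closed_segment_eq_real_ivl)
    next
      case False
      with MVT2[of s 0 "\<lambda>s. f (v + s *\<^sub>R e) x" "\<lambda>r. f' (v + r *\<^sub>R e) x"] D z
      obtain \<xi> where "s < \<xi>" "\<xi> < 0" "f (v + 0 *\<^sub>R e) x - f (v + s *\<^sub>R e) x = (0 - s) * f' (v + \<xi> *\<^sub>R e) x"
        by (auto simp: closed_segment_eq_real_ivl)
      then show ?thesis using that[of \<xi>] z by (auto simp: Q_def closed_segment_eq_real_ivl field_simps)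
    qed
    show ?thesis
      unfolding \<xi>(2) by (rule SUP_upper[OF seg[OF \<xi>(1)]])
  qed
  have R_meas [measurable]: "R \<in> borel_measurable borel"
    unfolding R_def
  proof (rule borel_measurable_SUP[OF C'(1)])
    fix z assume "z \<in> C'"
    then obtain v s where z: "z = (v, s)" "v \<in> V" "v + s *\<^sub>R e \<in> V"
      using C' by (auto simp: C_def)
    have [measurable]: "(\<lambda>x. indicator X x * f v x) \<in> borel_measurable borel"
      "(\<lambda>x. indicator X x * f (v + s *\<^sub>R e) x) \<in> borel_measurable borel"
      using z by (auto intro: meas)
    have eq: "(\<lambda>x. indicator X x * \<bar>Q x z\<bar>) = (\<lambda>x. \<bar>(indicator X x * f (v + s *\<^sub>R e) x - indicator X x * f v x) / s\<bar>)"
      by (auto simp: Q_def z indicator_def)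
    have "(\<lambda>x. indicator X x * \<bar>Q x z\<bar>) \<in> borel_measurable borel"
      unfolding eq by measurable
    then show "(\<lambda>x. ennreal (indicator X x * \<bar>Q x z\<bar>)) \<in> borel_measurable borel"
      by simp
  qed
  have "(\<integral>\<^sup>+x. R x \<partial>lborel) \<le> (\<integral>\<^sup>+x\<in>X. (SUP v\<in>V. ennreal \<bar>f' v x\<bar>) \<partial>lborel)"
  proof (intro nn_integral_mono)
    fix x
    show "R x \<le> (SUP v\<in>V. ennreal \<bar>f' v x\<bar>) * indicator X x"
      unfolding R_def using C'(2)
      by (cases "x \<in> X") (auto intro!: SUP_least Q_le simp: bot_ennreal[symmetric])
  qed
  then have R_fin: "(\<integral>\<^sup>+x. R x \<partial>lborel) < \<infinity>"
    using fin by (rule le_less_trans)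
  have R_AE: "AE x in lborel. R x \<noteq> \<infinity>"
    using R_fin by (intro nn_integral_PInf_AE) auto
  have int_M: "integrable lborel (\<lambda>x. enn2real (R x))"
  proof (rule integrableI_bounded)
    have "(\<integral>\<^sup>+x. ennreal (norm (enn2real (R x))) \<partial>lborel) = (\<integral>\<^sup>+x. R x \<partial>lborel)"
      using R_AE by (intro nn_integral_cong_AE) (auto elim!: eventually_mono simp: less_top)
    then show "(\<integral>\<^sup>+x. ennreal (norm (enn2real (R x))) \<partial>lborel) < \<infinity>"
      using R_fin by simp
  qed measurable
  \<comment> \<open>The bound holds on the dense set \<open>C'\<close> by definition of
    \<open>R\<close> and passes to all of \<open>C\<close> by continuity of the quotient. Finiteness
    of \<open>R x\<close> makes the conversion to a real number faithful.\<close>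
  have lip: "\<bar>f (v + s *\<^sub>R e) x - f v x\<bar> \<le> \<bar>s\<bar> * enn2real (R x)"
    if x: "x \<in> X" and R: "R x \<noteq> \<infinity>" and vs: "v \<in> V" "v + s *\<^sub>R e \<in> V" for x v s
  proof (cases "s = 0")
    case False
    then have "(v, s) \<in> C" using vs by (simp add: C_def)
    then obtain z where z: "\<And>n. z n \<in> C'" "z \<longlonglongrightarrow> (v, s)"
      using C'(3) closure_sequential by blast
    have "continuous_on C (\<lambda>z. \<bar>Q x z\<bar>)"
      unfolding Q_def split_beta' C_def
      by (intro continuous_intros continuous_on_compose2[OF cont[OF x]]) (auto simp: split_beta')
    then have "(\<lambda>n. \<bar>Q x (z n)\<bar>) \<longlonglongrightarrow> \<bar>Q x (v, s)\<bar>"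
      by (rule continuous_on_tendsto_compose[OF _ z(2) \<open>(v, s) \<in> C\<close>]) (use z(1) C'(2) in \<open>auto intro!: always_eventually\<close>)
    moreover have "\<bar>Q x (z n)\<bar> \<le> enn2real (R x)" for n
    proof -
      have "ennreal \<bar>Q x (z n)\<bar> \<le> R x"
        unfolding R_def using SUP_upper[OF z(1), of "\<lambda>z. ennreal (indicator X x * \<bar>Q x z\<bar>)"] x by simp
      also have "R x = ennreal (enn2real (R x))"
        using R by (simp add: less_top)
      finally show ?thesis by (simp add: ennreal_le_iff)
    qed
    ultimately have "\<bar>Q x (v, s)\<bar> \<le> enn2real (R x)"
      by (intro LIMSEQ_le_const2) auto
    then show ?thesis using False by (simp add: Q_def field_simps)
  qed simp
  show ?thesis
    using R_AE by (intro that[OF int_M]) (auto elim!: eventually_mono intro: lip)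
qed

text \<open>Dominated convergence applied to the remainder of the total derivative, divided by the
  distance to \<open>t\<close>. The bound at \<open>t\<close> alone also controls \<open>D\<close>,
  so its integrability is a conclusion and not a hypothesis.\<close>

lemma has_derivative_integral_dominated:
  fixes g :: "'a::euclidean_space \<Rightarrow> 'b \<Rightarrow> real"
  assumes r: "r > 0" and int: "\<And>v. v \<in> ball t r \<Longrightarrow> integrable N (g v)"
    and D: "AE x in N. ((\<lambda>v. g v x) has_derivative (\<lambda>h. h \<bullet> D x)) (at t)"
    and D_meas [measurable]: "D \<in> borel_measurable N"
    and M: "integrable N M"
    and lip: "AE x in N. \<forall>v\<in>ball t r. \<bar>g v x - g t x\<bar> \<le> norm (v - t) * M x"
  shows "integrable N D" and "((\<lambda>v. \<integral>x. g v x \<partial>N) has_derivative (\<lambda>h. h \<bullet> (\<integral>x. D x \<partial>N))) (at t)"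
proof -
  have t: "t \<in> ball t r" using r by simp
  \<comment> \<open>Differentiating in the direction of \<open>D x\<close> itself gives
    \<open>D x \<bullet> D x\<close> on one side and at most \<open>norm (D x) * M x\<close> on the
    other.\<close>
  have D_le: "AE x in N. norm (D x) \<le> M x"
    using D lip
  proof eventually_elim
    case (elim x)
    show ?case
    proof (cases "D x = 0")
      \<comment> \<open>Here the claim is \<open>0 \<le> M x\<close>, which is read off from the
        Lipschitz bound at a point of the ball other than \<open>t\<close>.\<close>
      case True
      define b where "b = (SOME b::'a. b \<in> Basis)"
      have b: "b \<in> Basis" unfolding b_def by (rule some_in_eq[THEN iffD2]) simp
      have "t + (r/2) *\<^sub>R b \<in> ball t r" using r b by (simp add: dist_norm)
      then have "0 \<le> norm (t + (r/2) *\<^sub>R b - t) * M x"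
        using elim(2) by (meson abs_ge_zero order_trans)
      then show ?thesis using True r b by (simp add: zero_le_mult_iff)
    next
      case False
      have "((\<lambda>s. t + s *\<^sub>R D x) has_derivative (\<lambda>s. s *\<^sub>R D x)) (at 0)"
        by (auto intro!: derivative_eq_intros)
      from has_derivative_compose[OF this, of "\<lambda>v. g v x" "\<lambda>h. h \<bullet> D x"] elim(1)
      have "((\<lambda>s. g (t + s *\<^sub>R D x) x) has_derivative (\<lambda>s. (s *\<^sub>R D x) \<bullet> D x)) (at 0)"
        by simp
      then have "((\<lambda>s. g (t + s *\<^sub>R D x) x) has_real_derivative D x \<bullet> D x) (at 0)"
        by (auto simp: has_field_derivative_def mult.commute elim!: has_derivative_eq_rhs)
      then have "((\<lambda>s. (g (t + s *\<^sub>R D x) x - g t x) / s) \<longlongrightarrow> D x \<bullet> D x) (at 0)"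
        by (simp add: DERIV_def)
      then have "((\<lambda>s. \<bar>(g (t + s *\<^sub>R D x) x - g t x) / s\<bar>) \<longlongrightarrow> \<bar>D x \<bullet> D x\<bar>) (at 0)"
        by (rule tendsto_rabs)
      moreover have "\<forall>\<^sub>F s in at (0::real). \<bar>(g (t + s *\<^sub>R D x) x - g t x) / s\<bar> \<le> norm (D x) * M x"
        unfolding eventually_at
      proof (intro exI[of _ "r / norm (D x)"] conjI ballI impI)
        show "0 < r / norm (D x)" using r False by simp
        fix s :: real assume s: "s \<noteq> 0 \<and> dist s 0 < r / norm (D x)"
        then have "t + s *\<^sub>R D x \<in> ball t r" using False by (simp add: dist_norm field_simps)
        then have "\<bar>g (t + s *\<^sub>R D x) x - g t x\<bar> \<le> norm (t + s *\<^sub>R D x - t) * M x"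
          using elim(2) by blast
        then show "\<bar>(g (t + s *\<^sub>R D x) x - g t x) / s\<bar> \<le> norm (D x) * M x"
          using s by (simp add: field_simps)
      qed
      ultimately have "\<bar>D x \<bullet> D x\<bar> \<le> norm (D x) * M x"
        by (rule tendsto_upperbound) simp
      then have "norm (D x) * norm (D x) \<le> norm (D x) * M x"
        by (simp add: dot_square_norm power2_eq_square)
      then show ?thesis using False by simp
    qed
  qed
  show int_D: "integrable N D"
    by (rule Bochner_Integration.integrable_bound[OF M D_meas]) (use D_le in \<open>auto elim!: eventually_mono\<close>)
  let ?I = "\<lambda>v. \<integral>x. g v x \<partial>N"
  let ?u = "\<lambda>v x. (g v x - g t x - (v - t) \<bullet> D x) / norm (v - t)"
  have int_inner: "(\<integral>x. h \<bullet> D x \<partial>N) = h \<bullet> (\<integral>x. D x \<partial>N)" for h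
    using int_D by simp
  have "((\<lambda>v. \<integral>x. ?u v x \<partial>N) \<longlongrightarrow> 0) (at t)"
    unfolding tendsto_at_iff_sequentially comp_def
  proof (intro allI impI)
    fix v :: "nat \<Rightarrow> 'a" assume v: "\<forall>i. v i \<in> UNIV - {t}" "v \<longlonglongrightarrow> t"
    have ev: "\<forall>\<^sub>F n in sequentially. v n \<in> ball t r"
      using v(2) t by (rule topological_tendstoD[OF _ open_ball])
    \<comment> \<open>Dropping the first \<open>n0\<close> terms puts the whole sequence into the
      ball, where integrability and the bound are available.\<close>
    then obtain n0 where n0: "\<And>n. n \<ge> n0 \<Longrightarrow> v n \<in> ball t r"
      by (auto simp: eventually_sequentially)
    have "(\<lambda>n. \<integral>x. ?u (v (n + n0)) x \<partial>N) \<longlonglongrightarrow> (\<integral>x. 0 \<partial>N)"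
    proof (rule integral_dominated_convergence[where w = "\<lambda>x. 2 * M x"])
      show "(\<lambda>x. 0) \<in> borel_measurable N" by simp
      show "?u (v (n + n0)) \<in> borel_measurable N" for n
        using borel_measurable_integrable[OF int[OF n0[of "n + n0"]]] borel_measurable_integrable[OF int[OF t]]
        by (intro borel_measurable_divide borel_measurable_diff borel_measurable_inner D_meas) auto
      show "integrable N (\<lambda>x. 2 * M x)" using M by simp
      show "AE x in N. (\<lambda>n. ?u (v (n + n0)) x) \<longlonglongrightarrow> 0"
        using D
      proof eventually_elim
        case (elim x)
        then have "((\<lambda>w. norm (?u w x)) \<longlongrightarrow> 0) (at t)"
          by (simp add: has_derivative_iff_norm)
        then have "((\<lambda>w. ?u w x) \<longlongrightarrow> 0) (at t)"
          by (rule tendsto_norm_zero_cancel)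
        then have "(\<lambda>n. ?u (v n) x) \<longlonglongrightarrow> 0"
          using v unfolding tendsto_at_iff_sequentially comp_def by auto
        then show ?case by (rule LIMSEQ_ignore_initial_segment)
      qed
      show "AE x in N. norm (?u (v (n + n0)) x) \<le> 2 * M x" for n
        using lip D_le
      proof eventually_elim
        case (elim x)
        let ?w = "v (n + n0)"
        have w: "norm (?w - t) > 0" using v(1) by auto
        have "\<bar>g ?w x - g t x - (?w - t) \<bullet> D x\<bar> \<le> \<bar>g ?w x - g t x\<bar> + \<bar>(?w - t) \<bullet> D x\<bar>"
          by (rule abs_triangle_ineq4)
        also have "\<dots> \<le> norm (?w - t) * M x + norm (?w - t) * M x"
          using elim(1) n0[of "n + n0"] Cauchy_Schwarz_ineq2[of "?w - t" "D x"] elim(2)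
          by (intro add_mono order_trans[OF Cauchy_Schwarz_ineq2] mult_left_mono) auto
        finally show ?case using w by (simp add: field_simps)
      qed
    qed
    then show "(\<lambda>n. \<integral>x. ?u (v n) x \<partial>N) \<longlonglongrightarrow> 0"
      by (simp add: LIMSEQ_offset)
  qed
  moreover have "\<forall>\<^sub>F v in at t. (\<integral>x. ?u v x \<partial>N) = (?I v - ?I t - (v - t) \<bullet> (\<integral>x. D x \<partial>N)) / norm (v - t)"
    unfolding eventually_at
  proof (intro exI[of _ r] conjI r ballI impI)
    fix v assume "v \<noteq> t \<and> dist v t < r"
    then have "v \<in> ball t r" by (simp add: dist_commute)
    from int[OF this] int[OF t] int_D
    show "(\<integral>x. ?u v x \<partial>N) = (?I v - ?I t - (v - t) \<bullet> (\<integral>x. D x \<partial>N)) / norm (v - t)"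
      by (simp add: int_inner)
  qed
  ultimately have "((\<lambda>v. (?I v - ?I t - (v - t) \<bullet> (\<integral>x. D x \<partial>N)) / norm (v - t)) \<longlongrightarrow> 0) (at t)"
    by (rule Lim_transform_eventually)
  from tendsto_norm_zero[OF this]
  show "(?I has_derivative (\<lambda>h. h \<bullet> (\<integral>x. D x \<partial>N))) (at t)"
    by (simp add: has_derivative_iff_norm bounded_linear_inner_left)
qed

text \<open>Unlike the almost everywhere version, this holds at every point of continuity. The base
  point \<open>x - 1\<close> leaves room on both sides of \<open>x\<close>.\<close>

lemma DERIV_set_integral_atMost:
  fixes f :: "real \<Rightarrow> real"
  assumes f: "integrable lborel f" and x: "isCont f x"
  shows "((\<lambda>x. LBINT y:{..x}. f y) has_real_derivative f x) (at x)"
proof -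
  have HK: "f integrable_on {c..d}" for c d
    by (rule integrable_on_subinterval[OF integrable_on_lborel[OF f]]) simp
  have "((\<lambda>u. integral {x - 1..u} f) has_vector_derivative f x) (at x within {x - 1..x + 1} - {})"
    by (rule integral_has_vector_derivative_continuous_at[OF HK])
      (use x in \<open>auto intro: continuous_at_imp_continuous_at_within\<close>)
  then have "((\<lambda>u. integral {x - 1..u} f) has_real_derivative f x) (at x within {x - 1..x + 1})"
    by (simp add: has_real_derivative_iff_has_vector_derivative)
  moreover have "at x within {x - 1..x + 1} = at x"
    by (rule at_within_interior) (simp add: interior_atLeastAtMost_real)
  ultimately have "((\<lambda>u. (LBINT y:{..x - 1}. f y) + integral {x - 1..u} f) has_real_derivative 0 + f x) (at x)"
    by (intro DERIV_add DERIV_const) simp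
  then have D: "((\<lambda>u. (LBINT y:{..x - 1}. f y) + integral {x - 1..u} f) has_real_derivative f x) (at x)"
    by simp
  show ?thesis
  proof (rule has_field_derivative_transform_within_open[OF D])
    show "open {x - 1<..}" "x \<in> {x - 1<..}" by auto
    fix u assume "u \<in> {x - 1<..}"
    then show "(LBINT y:{..x - 1}. f y) + integral {x - 1..u} f = (LBINT y:{..u}. f y)"
      using set_integral_atMost_diff[OF f, of "x - 1" u] by simp
  qed
qed

section \<open>Differentiability of products containing a composition with \<open>q\<close>\<close>

text \<open>The curve \<open>c\<close> need not be injective, but near 0 it has a right inverse
  \<open>\<sigma>\<close> that is differentiable at \<open>c 0\<close>. Then \<open>q\<close> is the
  composition of \<open>q \<circ> c\<close> with \<open>\<sigma>\<close> near that point.\<close>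

lemma DERIV_of_DERIV_compose:
  fixes q c :: "real \<Rightarrow> real"
  assumes c: "(c has_real_derivative c') (at 0)" and c': "c' \<noteq> 0"
    and cont: "r > 0" "\<And>s. \<bar>s\<bar> < r \<Longrightarrow> isCont c s"
    and qc: "((\<lambda>s. q (c s)) has_real_derivative d) (at 0)"
  shows "(q has_real_derivative d / c') (at (c 0))"
proof -
  obtain r1 where r1: "r1 > 0" "\<And>s. \<bar>s\<bar> < r1 \<Longrightarrow> \<bar>c s - c 0 - c' * s\<bar> \<le> \<bar>c'\<bar> / 2 * \<bar>s\<bar>"
  proof -
    have "(c has_derivative (*) c') (at 0)" using c by (simp add: has_field_derivative_def)
    then have "\<exists>r1>0. \<forall>s. norm (s - 0) < r1 \<longrightarrow> norm (c s - c 0 - c' * (s - 0)) \<le> \<bar>c'\<bar> / 2 * norm (s - 0)"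
      unfolding has_derivative_at_alt using c' by (metis zero_less_abs_iff half_gt_zero)
    then show ?thesis using that by auto
  qed
  define \<rho> where "\<rho> = min r r1 * \<bar>c'\<bar> / 2"
  have \<rho>: "\<rho> > 0" using r1 cont(1) c' by (simp add: \<rho>_def)
  have "\<exists>s. c s = y \<and> \<bar>s\<bar> \<le> 2 * \<bar>y - c 0\<bar> / \<bar>c'\<bar>" if y: "\<bar>y - c 0\<bar> < \<rho>" for y
  proof -
    \<comment> \<open>Twice the step predicted by the linear approximation. The error is at most
      \<open>\<bar>y - c 0\<bar>\<close>, so \<open>c s1\<close> overshoots \<open>y\<close> and the
      intermediate value theorem applies between 0 and \<open>s1\<close>. The radius
      \<open>\<rho>\<close> is chosen so that \<open>s1\<close> stays in range.\<close>
    define s1 where "s1 = 2 * (y - c 0) / c'"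
    have abs_s1: "\<bar>s1\<bar> = 2 * \<bar>y - c 0\<bar> / \<bar>c'\<bar>" unfolding s1_def abs_divide abs_mult by simp
    have s1: "\<bar>s1\<bar> < r" "\<bar>s1\<bar> < r1"
      using y c' by (auto simp: abs_s1 \<rho>_def field_simps min_mult_distrib_left min_mult_distrib_right split: if_splits)
    have "\<bar>c s1 - c 0 - 2 * (y - c 0)\<bar> \<le> \<bar>y - c 0\<bar>"
    proof -
      have "c' * s1 = 2 * (y - c 0)" using c' by (simp add: s1_def)
      moreover have "\<bar>c'\<bar> / 2 * \<bar>s1\<bar> = \<bar>y - c 0\<bar>" using c' by (simp add: abs_s1)
      ultimately show ?thesis using r1(2)[OF s1(2)] by metis
    qed
    then have btw: "c 0 \<le> y \<and> y \<le> c s1 \<or> c s1 \<le> y \<and> y \<le> c 0"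
      by (cases "y \<ge> c 0") auto
    have "continuous_on (closed_segment 0 s1) c"
    proof (intro continuous_at_imp_continuous_on ballI cont(2))
      fix s assume "s \<in> closed_segment 0 s1"
      then have "\<bar>s\<bar> \<le> \<bar>s1\<bar>" by (auto simp: closed_segment_eq_real_ivl split: if_splits)
      then show "\<bar>s\<bar> < r" using s1 by linarith
    qed
    then have "is_interval (c ` closed_segment 0 s1)"
      by (simp add: is_interval_connected_1 connected_continuous_image)
    then have "y \<in> c ` closed_segment 0 s1"
      using btw mem_is_interval_1_I[of "c ` closed_segment 0 s1"] by (metis ends_in_segment imageI)
    then obtain s where s: "s \<in> closed_segment 0 s1" "y = c s" by auto
    then have "\<bar>s\<bar> \<le> \<bar>s1\<bar>" by (auto simp: closed_segment_eq_real_ivl split: if_splits)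
    then show ?thesis using s abs_s1 by auto
  qed
  then obtain \<sigma> where \<sigma>: "\<And>y. \<bar>y - c 0\<bar> < \<rho> \<Longrightarrow> c (\<sigma> y) = y"
      "\<And>y. \<bar>y - c 0\<bar> < \<rho> \<Longrightarrow> \<bar>\<sigma> y\<bar> \<le> 2 * \<bar>y - c 0\<bar> / \<bar>c'\<bar>"
    by metis
  have \<sigma>0: "\<sigma> (c 0) = 0" using \<sigma>(2)[of "c 0"] \<rho> by simp
  have ev: "\<forall>\<^sub>F y in at (c 0). \<bar>y - c 0\<bar> < \<rho>"
    unfolding eventually_at using \<rho> by (auto simp: dist_real_def)
  have "(\<sigma> \<longlongrightarrow> 0) (at (c 0))"
  proof (rule Lim_null_comparison)
    show "\<forall>\<^sub>F y in at (c 0). norm (\<sigma> y) \<le> 2 * \<bar>y - c 0\<bar> / \<bar>c'\<bar>"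
      using ev by eventually_elim (simp add: \<sigma>(2))
    show "((\<lambda>y. 2 * \<bar>y - c 0\<bar> / \<bar>c'\<bar>) \<longlongrightarrow> 0) (at (c 0))"
      using c' by (auto intro!: tendsto_eq_intros)
  qed
  then have "isCont \<sigma> (c 0)" by (simp add: isCont_def \<sigma>0)
  then have "(\<sigma> has_real_derivative inverse c') (at (c 0))"
    using c c' \<rho> \<sigma>(1) by (intro DERIV_inverse_function[of c c' \<sigma> "c 0" "c 0 - \<rho>" "c 0 + \<rho>"]) (auto simp: \<sigma>0)
  then have "((\<lambda>y. q (c (\<sigma> y))) has_real_derivative d * inverse c') (at (c 0))"
    using DERIV_chain2[of "\<lambda>s. q (c s)" d \<sigma> "c 0"] qc by (simp add: \<sigma>0)
  then have "(q has_real_derivative d * inverse c') (at (c 0))"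
    by (rule has_field_derivative_transform_within[of _ _ _ _ \<rho>]) (use \<rho> \<sigma>(1) in \<open>auto simp: dist_real_def\<close>)
  then show ?thesis by (simp add: divide_inverse)
qed

text \<open>Since \<open>\<psi>\<close> vanishes at \<open>t\<close>, the increment of
  \<open>f\<close> is multiplied by a quantity of first order. Its convergence to zero is then
  enough, and no derivative of \<open>f\<close> enters.\<close>

lemma has_derivative_mult_zero:
  fixes f \<psi> :: "'a::euclidean_space \<Rightarrow> real"
  assumes f: "isCont f t" and \<psi>: "(\<psi> has_derivative D) (at t)" and zero: "\<psi> t = 0"
  shows "((\<lambda>v. f v * \<psi> v) has_derivative (\<lambda>h. f t * D h)) (at t)"
proof -
  have bl: "bounded_linear D" using \<psi> by (rule has_derivative_bounded_linear)
  obtain K where K: "\<And>h. norm (D h) \<le> norm h * K" using bounded_linear.bounded[OF bl] by blast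
  have 1: "((\<lambda>v. (\<psi> v - \<psi> t - D (v - t)) / norm (v - t)) \<longlongrightarrow> 0) (at t)"
  proof (rule tendsto_norm_zero_cancel)
    show "((\<lambda>v. norm ((\<psi> v - \<psi> t - D (v - t)) / norm (v - t))) \<longlongrightarrow> 0) (at t)"
      using \<psi> by (simp add: has_derivative_iff_norm)
  qed
  have f_lim: "(f \<longlongrightarrow> f t) (at t)" using f by (simp add: isCont_def)
  have "((\<lambda>v. f v * ((\<psi> v - \<psi> t - D (v - t)) / norm (v - t))) \<longlongrightarrow> f t * 0) (at t)"
    by (intro tendsto_mult f_lim 1)
  moreover have "((\<lambda>v. (f v - f t) * (D (v - t) / norm (v - t))) \<longlongrightarrow> 0) (at t)"
  proof (rule Lim_null_comparison)
    show "((\<lambda>v. \<bar>f v - f t\<bar> * K) \<longlongrightarrow> 0) (at t)"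
      by (rule tendsto_eq_intros f_lim refl)+ simp
    show "\<forall>\<^sub>F v in at t. norm ((f v - f t) * (D (v - t) / norm (v - t))) \<le> \<bar>f v - f t\<bar> * K"
      unfolding eventually_at
    proof (intro exI[of _ 1] conjI ballI impI)
      fix v assume "v \<noteq> t \<and> dist v t < 1"
      then have "\<bar>D (v - t) / norm (v - t)\<bar> \<le> K"
        using K[of "v - t"] by (simp add: field_simps)
      then show "norm ((f v - f t) * (D (v - t) / norm (v - t))) \<le> \<bar>f v - f t\<bar> * K"
        unfolding real_norm_def abs_mult[of "f v - f t"] by (intro mult_left_mono) auto
    qed simp
  qed
  ultimately have "((\<lambda>v. f v * ((\<psi> v - \<psi> t - D (v - t)) / norm (v - t)) +
      (f v - f t) * (D (v - t) / norm (v - t))) \<longlongrightarrow> f t * 0 + 0) (at t)"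
    by (rule tendsto_add)
  moreover have "f v * ((\<psi> v - \<psi> t - D (v - t)) / norm (v - t)) + (f v - f t) * (D (v - t) / norm (v - t)) =
      (f v * \<psi> v - f t * \<psi> t - f t * D (v - t)) / norm (v - t)" for v
    unfolding times_divide_eq_right add_divide_distrib[symmetric] by (simp add: zero algebra_simps)
  ultimately have "((\<lambda>v. (f v * \<psi> v - f t * \<psi> t - f t * D (v - t)) / norm (v - t)) \<longlongrightarrow> 0) (at t)"
    by simp
  from tendsto_norm_zero[OF this]
  show ?thesis
    unfolding has_derivative_iff_norm by (auto intro: bounded_linear_const_mult bl)
qed

lemma has_derivative_grad:
  fixes f :: "real^'d::finite \<Rightarrow> real"
  assumes "f differentiable (at v)"
  shows "(f has_derivative (\<lambda>h. h \<bullet> grad f v)) (at v)"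
proof -
  obtain D where D: "(f has_derivative D) (at v)"
    using assms by (auto simp: differentiable_def)
  have "D h = h \<bullet> grad f v" for h
  proof -
    have "D h = D (\<Sum>i\<in>UNIV. (h $ i) *\<^sub>R axis i 1)"
      by (simp add: basis_expansion scalar_mult_eq_scaleR[symmetric])
    also have "\<dots> = (\<Sum>i\<in>UNIV. h $ i * D (axis i 1))"
      using has_derivative_linear[OF D] by (simp add: linear_sum linear_cmul)
    also have "\<dots> = h \<bullet> grad f v"
      by (simp add: inner_vec_def grad_def partial_eqI[OF D])
    finally show ?thesis .
  qed
  then have "D = (\<lambda>h. h \<bullet> grad f v)" by (rule ext)
  with D show ?thesis by simp
qed

lemma has_hessian_imp_differentiable:
  assumes "has_hessian f H t"
  shows "f differentiable (at t)"
  using assms unfolding has_hessian_def by (auto dest: eventually_nhds_x_imp_x)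

text \<open>Along the \<open>j\<close>-th coordinate line \<open>\<phi>\<close> is a curve with
  nonzero speed at \<open>t\<close>, so a derivative of the composition along this line passes to
  \<open>q\<close>.\<close>

lemma DERIV_from_partial:
  fixes \<phi> :: "real^'d::finite \<Rightarrow> real"
  assumes diff: "\<forall>\<^sub>F v in nhds t. \<phi> differentiable (at v)"
    and part: "has_partial j (\<lambda>v. q (\<phi> v)) t" and nz: "partial j \<phi> t \<noteq> 0"
  shows "(q has_real_derivative partial j (\<lambda>v. q (\<phi> v)) t / partial j \<phi> t) (at (\<phi> t))"
proof -
  obtain r where r: "r > 0" "\<And>v. dist v t < r \<Longrightarrow> \<phi> differentiable (at v)"
    using diff unfolding eventually_nhds_metric by blast
  have D: "((\<lambda>s. \<phi> (t + s *\<^sub>R axis j 1)) has_real_derivative partial j \<phi> (t + s *\<^sub>R axis j 1)) (at s)"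
    if "\<bar>s\<bar> < r" for s
    using that by (intro has_partial_DERIV differentiable_imp_has_partial r(2)) (simp add: dist_norm)
  have "(q has_real_derivative partial j (\<lambda>v. q (\<phi> v)) t / partial j \<phi> t) (at (\<phi> (t + 0 *\<^sub>R axis j 1)))"
  proof (rule DERIV_of_DERIV_compose[where c = "\<lambda>s. \<phi> (t + s *\<^sub>R axis j 1)", OF _ nz r(1)])
    show "((\<lambda>s. \<phi> (t + s *\<^sub>R axis j 1)) has_real_derivative partial j \<phi> t) (at 0)"
      using D[of 0] r by simp
    show "isCont (\<lambda>s. \<phi> (t + s *\<^sub>R axis j 1)) s" if "\<bar>s\<bar> < r" for s
      using D[OF that] by (rule DERIV_isCont)
    show "((\<lambda>s. q (\<phi> (t + s *\<^sub>R axis j 1))) has_real_derivative partial j (\<lambda>v. q (\<phi> v)) t) (at 0)"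
      using has_partial_DERIV[of j "\<lambda>v. q (\<phi> v)" t 0] part by simp
  qed
  then show ?thesis by simp
qed

lemma partial_compose:
  fixes \<phi> :: "real^'d::finite \<Rightarrow> real"
  assumes \<phi>: "\<phi> differentiable (at t)" and q: "(q has_real_derivative \<gamma>) (at (\<phi> t))"
  shows "((\<lambda>v. q (\<phi> v)) has_derivative (\<lambda>h. \<gamma> * (h \<bullet> grad \<phi> t))) (at t)"
    and "partial i (\<lambda>v. q (\<phi> v)) t = \<gamma> * partial i \<phi> t"
proof -
  show D: "((\<lambda>v. q (\<phi> v)) has_derivative (\<lambda>h. \<gamma> * (h \<bullet> grad \<phi> t))) (at t)"
    using has_derivative_compose[OF has_derivative_grad[OF \<phi>], of q "(*) \<gamma>"] q
    by (simp add: has_field_derivative_def)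
  show "partial i (\<lambda>v. q (\<phi> v)) t = \<gamma> * partial i \<phi> t"
    using partial_eqI[OF D, of i] by (simp add: grad_def inner_axis')
qed

text \<open>Only the partial derivatives of \<open>v \<mapsto> q (\<phi> v)\<close> are known to exist. If \<open>partial j \<phi> t \<noteq> 0\<close>
  they force \<open>q\<close> to be differentiable at \<open>\<phi> t\<close>; if \<open>partial j \<phi> t = 0\<close>, continuity of \<open>q\<close> is enough.\<close>

lemma has_derivative_compose_mult_partial:
  fixes \<phi> :: "real^'d::finite \<Rightarrow> real"
  assumes H: "has_hessian \<phi> H t" and q: "isCont q (\<phi> t)"
    and part: "has_partial j (\<lambda>v. q (\<phi> v)) t"
  shows "((\<lambda>v. (q (\<phi> v) - x) * partial j \<phi> v) has_derivative
    (\<lambda>h. h \<bullet> ((q (\<phi> t) - x) *\<^sub>R H $ j + partial j \<phi> t *\<^sub>R grad (\<lambda>v. q (\<phi> v)) t))) (at t)"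
proof -
  have \<phi>: "\<phi> differentiable (at t)" by (rule has_hessian_imp_differentiable[OF H])
  have \<psi>: "(partial j \<phi> has_derivative (\<lambda>h. h \<bullet> H $ j)) (at t)"
    using has_hessian_imp_has_derivative_partial[OF H, of j]
    by (simp add: matrix_vector_mul_component inner_commute)
  show ?thesis
  proof (cases "partial j \<phi> t = 0")
    case True
    have "isCont (\<lambda>v. q (\<phi> v) - x) t"
      using isCont_o2[OF differentiable_imp_continuous_within[OF \<phi>] q] by simp
    from has_derivative_mult_zero[OF this \<psi> True] show ?thesis
      by (simp add: True inner_add_right)
  next
    case False
    obtain \<gamma> where \<gamma>: "(q has_real_derivative \<gamma>) (at (\<phi> t))"
      using DERIV_from_partial[OF _ part False] H by (auto simp: has_hessian_def)
    have "grad (\<lambda>v. q (\<phi> v)) t = \<gamma> *\<^sub>R grad \<phi> t"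
      by (simp add: vec_eq_iff grad_def partial_compose(2)[OF \<phi> \<gamma>])
    then show ?thesis
      by (auto intro!: derivative_eq_intros partial_compose(1)[OF \<phi> \<gamma>] \<psi> simp: algebra_simps)
  qed
qed

text \<open>Trades the derivative of the transport map in \<open>x\<close> for its partial
  derivatives in the parameter: with \<open>\<gamma>\<close> the derivative of \<open>q\<close>,
  both sides are \<open>\<gamma> * d\<close> times the two partial derivatives of
  \<open>\<phi>\<close>. If \<open>partial j \<phi> t = 0\<close>, both sides vanish, whatever value
  \<open>deriv\<close> takes.\<close>

lemma deriv_compose_mult_partial:
  fixes \<phi> :: "real^'d::finite \<Rightarrow> real"
  assumes H: "has_hessian \<phi> H t" and part: "has_partial j (\<lambda>v. q (\<phi> v)) t"
    and G: "(G has_real_derivative d) (at x)" "G x = \<phi> t"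
  shows "deriv (\<lambda>x. q (G x)) x * (partial i \<phi> t * partial j \<phi> t) =
    d * (partial i (\<lambda>v. q (\<phi> v)) t * partial j \<phi> t)"
proof (cases "partial j \<phi> t = 0")
  case False
  have \<phi>: "\<phi> differentiable (at t)" by (rule has_hessian_imp_differentiable[OF H])
  obtain \<gamma> where \<gamma>: "(q has_real_derivative \<gamma>) (at (\<phi> t))"
    using DERIV_from_partial[OF _ part False] H by (auto simp: has_hessian_def)
  then have "((\<lambda>x. q (G x)) has_real_derivative \<gamma> * d) (at x)"
    using G by (intro DERIV_chain2) simp_all
  then show ?thesis
    by (simp add: DERIV_imp_deriv partial_compose(2)[OF \<phi> \<gamma>])
qed simp

section \<open>Measurability of partial derivatives and integrals of vectors\<close>

text \<open>A partial derivative is the pointwise limit of difference quotients along a sequence of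
  steps that stay inside \<open>S\<close>.\<close>

lemma borel_measurable_partial:
  fixes f :: "real^'d::finite \<Rightarrow> real \<Rightarrow> real"
  assumes "open S" "v \<in> S"
    and meas: "\<And>w. w \<in> S \<Longrightarrow> (\<lambda>x. indicator X x * f w x) \<in> borel_measurable borel"
    and part: "\<And>x. x \<in> X \<Longrightarrow> has_partial i (\<lambda>v. f v x) v"
  shows "(\<lambda>x. indicator X x * partial i (\<lambda>v. f v x) v) \<in> borel_measurable borel"
proof -
  obtain r where r: "r > 0" "ball v r \<subseteq> S" using assms(1,2) openE by blast
  define s where "s = (\<lambda>n. r / (2 * (real n + 1)))"
  have s: "s n > 0" "s n < r" for n
  proof -
    show "s n > 0" using r by (simp add: s_def)
    have "s n \<le> r / 2" unfolding s_def using r by (intro divide_left_mono) auto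
    then show "s n < r" using r by linarith
  qed
  have s_lim: "s \<longlonglongrightarrow> 0"
    unfolding s_def by real_asymp
  have in_S: "v + s n *\<^sub>R axis i 1 \<in> S" for n
    using s[of n] r by (intro subsetD[OF r(2)]) (simp add: dist_norm)
  show ?thesis
  proof (rule borel_measurable_LIMSEQ_real)
    show "(\<lambda>n. (indicator X x * f (v + s n *\<^sub>R axis i 1) x - indicator X x * f v x) / s n)
        \<longlonglongrightarrow> indicator X x * partial i (\<lambda>v. f v x) v" for x
    proof (cases "x \<in> X")
      case True
      have "((\<lambda>s. (f (v + s *\<^sub>R axis i 1) x - f v x) / s) \<longlongrightarrow> partial i (\<lambda>v. f v x) v) (at 0)"
        using has_partial_DERIV[of i "\<lambda>v. f v x" v 0] part[OF True] by (simp add: DERIV_def)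
      then have "(\<lambda>n. (f (v + s n *\<^sub>R axis i 1) x - f v x) / s n) \<longlonglongrightarrow> partial i (\<lambda>v. f v x) v"
        by (rule filterlim_compose) (use s(1) in \<open>auto simp: filterlim_at s_lim less_imp_neq[symmetric]\<close>)
      then show ?thesis using True by simp
    qed simp
    show "(\<lambda>x. (indicator X x * f (v + s n *\<^sub>R axis i 1) x - indicator X x * f v x) / s n) \<in> borel_measurable borel" for n
      by (intro borel_measurable_divide borel_measurable_diff meas in_S \<open>v \<in> S\<close>) simp
  qed
qed

lemma integrable_vecI:
  fixes f :: "'a \<Rightarrow> 'b::euclidean_space^'n::finite"
  assumes "\<And>j. integrable M (\<lambda>x. f x $ j)"
  shows "integrable M f"
proof -
  have bl: "bounded_linear (axis j :: 'b \<Rightarrow> 'b^'n)" for j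
    by (intro linear_conv_bounded_linear[THEN iffD1] linearI) (auto simp: axis_def vec_eq_iff)
  have "integrable M (\<lambda>x. \<Sum>j\<in>UNIV. axis j (f x $ j))"
    by (intro Bochner_Integration.integrable_sum integrable_bounded_linear[OF bl] assms)
  moreover have "(\<Sum>j\<in>UNIV. axis j (f x $ j)) = f x" for x
    by (simp add: vec_eq_iff axis_def if_distrib[of "\<lambda>z. z $ _"] cong: if_cong)
  ultimately show ?thesis by simp
qed

lemma integral_vec_nth:
  fixes f :: "'a \<Rightarrow> 'b::euclidean_space^'n::finite"
  assumes "integrable M f"
  shows "(\<integral>x. f x \<partial>M) $ j = (\<integral>x. f x $ j \<partial>M)"
  by (rule integral_bounded_linear[OF bounded_linear_vec_nth assms, symmetric])

section \<open>The Wasserstein distance on the line\<close>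

abbreviation U01 :: "real measure" where
  "U01 \<equiv> restrict_space lborel {0<..<1}"

lemma prob_space_U01: "prob_space U01"
  by (auto simp add: emeasure_restrict_space space_restrict_space intro!: prob_spaceI)

lemma space_U01 [simp]: "space U01 = {0<..<1}"
  by (simp add: space_restrict_space)

text \<open>Only the point 1 can be lost by intersecting with the open unit interval. For
  \<open>w < v\<close> the set is empty and \<open>ennreal\<close> truncates the negative difference
  to 0, so no case distinction is needed later.\<close>

lemma emeasure_U01_atMost_minus_atMost:
  assumes "0 \<le> v" "w \<le> 1"
  shows "emeasure U01 ({..w} \<inter> {v<..} \<inter> {0<..<1}) = ennreal (w - v)"
proof -
  have "emeasure U01 ({..w} \<inter> {v<..} \<inter> {0<..<1}) = emeasure lborel ({..w} \<inter> {v<..} \<inter> {0<..<1})"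
    by (subst emeasure_restrict_space) auto
  also have "\<dots> = emeasure lborel {v<..w}"
    using AE_lborel_singleton[of 1] assms by (intro emeasure_eq_AE) (auto elim!: eventually_mono)
  also have "\<dots> = ennreal (w - v)"
    by (cases "v \<le> w") (auto simp: ennreal_neg)
  finally show ?thesis .
qed

context real_distribution
begin

text \<open>The Galois connection through which events on quantiles become events on distribution
  functions.\<close>

lemma quantile_le_iff:
  assumes "u \<in> {0<..<1}"
  shows "quantile (cdf M) u \<le> x \<longleftrightarrow> u \<le> cdf M x"
proof -
  interpret cdf_distribution M ..
  show ?thesis
    using pseudoinverse[of u x] assms by (auto simp: quantile_def)
qed

lemma measurable_quantile [measurable]: "quantile (cdf M) \<in> borel_measurable U01"
proof -
  interpret cdf_distribution M ..
  have "quantile (cdf M) \<in> borel_measurable (restrict_space borel {0<..<1})"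
    using measurable_CI by (simp add: quantile_def[abs_def])
  then show ?thesis
    by (simp add: measurable_def space_restrict_space sets_restrict_space)
qed

text \<open>Inverse transform sampling; it gives the monotone coupling its marginals.\<close>

lemma distr_quantile: "distr U01 borel (quantile (cdf M)) = M"
proof -
  interpret cdf_distribution M ..
  show ?thesis
    using distr_I_eq_M by (simp add: quantile_def[abs_def])
qed

lemma integrable_quantile_sq:
  assumes "integrable M (\<lambda>x. x\<^sup>2)"
  shows "integrable U01 (\<lambda>u. (quantile (cdf M) u)\<^sup>2)"
  using assms by (subst (asm) distr_quantile[symmetric], subst (asm) integrable_distr_eq) auto

lemma integrable_quantile:
  assumes "integrable M (\<lambda>x. x\<^sup>2)"
  shows "integrable U01 (quantile (cdf M))"
proof -
  interpret U: prob_space U01 by (rule prob_space_U01)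
  show ?thesis
    using integrable_quantile_sq[OF assms] by (rule U.square_integrable_imp_integrable[rotated]) simp
qed

end

section \<open>Optimality of the monotone coupling\<close>

text \<open>For \<open>x \<le> y\<close> the square is twice the area of the triangle
  \<open>x \<le> s < r < y\<close>; the second indicator covers the reversed order. In this form the
  cost is a mixture of indicators of quadrants.\<close>

lemma sq_dist_eq_nn_integral:
  fixes x y :: real
  shows "ennreal (\<bar>x - y\<bar>\<^sup>2) = (\<integral>\<^sup>+s. \<integral>\<^sup>+r. 2 * indicator {s<..} r *
      (indicator {(x, y). x \<le> s \<and> r < y} (x, y) + indicator {(x, y). y \<le> s \<and> r < x} (x, y)) \<partial>lborel \<partial>lborel)"
proof -
  have *: "(\<integral>\<^sup>+s. \<integral>\<^sup>+r. 2 * indicator {s<..} r *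
      (indicator {(x, y). x \<le> s \<and> r < y} (x, y) + indicator {(x, y). y \<le> s \<and> r < x} (x, y)) \<partial>lborel \<partial>lborel) =
      ennreal ((y - x)\<^sup>2)" if "x \<le> y" for x y :: real
  proof -
    have "(\<integral>\<^sup>+r. 2 * indicator {s<..} r *
      (indicator {(x, y). x \<le> s \<and> r < y} (x, y) + indicator {(x, y). y \<le> s \<and> r < x} (x, y)) \<partial>lborel) =
      ennreal (2 * (y - s)) * indicator {x..y} s" for s
    proof -
      have "(\<integral>\<^sup>+r. 2 * indicator {s<..} r *
        (indicator {(x, y). x \<le> s \<and> r < y} (x, y) + indicator {(x, y). y \<le> s \<and> r < x} (x, y)) \<partial>lborel) =
        (\<integral>\<^sup>+r. 2 * indicator {x..y} s * indicator {s<..<y} r \<partial>lborel)"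
        using that by (intro nn_integral_cong) (auto simp: indicator_def)
      also have "\<dots> = 2 * indicator {x..y} s * emeasure lborel {s<..<y}"
        by (subst nn_integral_cmult_indicator) auto
      also have "\<dots> = ennreal (2 * (y - s)) * indicator {x..y} s"
        by (subst ennreal_mult') (auto simp: indicator_def)
      finally show ?thesis .
    qed
    then have "(\<integral>\<^sup>+s. \<integral>\<^sup>+r. 2 * indicator {s<..} r *
      (indicator {(x, y). x \<le> s \<and> r < y} (x, y) + indicator {(x, y). y \<le> s \<and> r < x} (x, y)) \<partial>lborel \<partial>lborel) =
      (\<integral>\<^sup>+s. ennreal (2 * (y - s)) * indicator {x..y} s \<partial>lborel)"
      by simp
    also have "\<dots> = ennreal (- ((y - y)\<^sup>2) - (- ((y - x)\<^sup>2)))"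
      using that by (intro nn_integral_FTC_Icc) (auto intro!: derivative_eq_intros)
    finally show ?thesis by simp
  qed
  show ?thesis
  proof (cases "x \<le> y")
    case True
    then show ?thesis
      using * by (simp add: power2_commute[of x y])
  next
    case False
    have "ennreal (\<bar>x - y\<bar>\<^sup>2) = (\<integral>\<^sup>+s. \<integral>\<^sup>+r. 2 * indicator {s<..} r *
      (indicator {(x, y). x \<le> s \<and> r < y} (y, x) + indicator {(x, y). y \<le> s \<and> r < x} (y, x)) \<partial>lborel \<partial>lborel)"
      using False *[of y x] by simp
    also have "\<dots> = (\<integral>\<^sup>+s. \<integral>\<^sup>+r. 2 * indicator {s<..} r *
      (indicator {(x, y). x \<le> s \<and> r < y} (x, y) + indicator {(x, y). y \<le> s \<and> r < x} (x, y)) \<partial>lborel \<partial>lborel)"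
      by (intro nn_integral_cong) (auto simp: indicator_def)
    finally show ?thesis .
  qed
qed

lemma sets_quadrants:
  fixes s r :: real
  shows "{(x, y). x \<le> s \<and> r < y} \<in> sets (borel \<Otimes>\<^sub>M borel)"
    and "{(x, y). y \<le> s \<and> r < x} \<in> sets (borel \<Otimes>\<^sub>M borel)"
proof -
  have "{(x, y). x \<le> s \<and> r < y} = {..s} \<times> {r<..}" "{(x, y). y \<le> s \<and> r < x} = {r<..} \<times> {..s}"
    by auto
  then show "{(x, y). x \<le> s \<and> r < y} \<in> sets (borel \<Otimes>\<^sub>M borel)"
    "{(x, y). y \<le> s \<and> r < x} \<in> sets (borel \<Otimes>\<^sub>M borel)"
    by simp_all
qed

text \<open>Two applications of Fubini carry the layer formula over to a coupling. Its cost depends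
  monotonically on the masses of quadrants, so couplings can be compared quadrant by
  quadrant.\<close>

lemma sq_cost_eq_nn_integral:
  fixes \<pi> :: "(real \<times> real) measure"
  assumes "prob_space \<pi>" and sets: "sets \<pi> = sets (borel \<Otimes>\<^sub>M borel)"
  shows "(\<integral>\<^sup>+ (x, y). ennreal (\<bar>x - y\<bar>\<^sup>2) \<partial>\<pi>) =
    (\<integral>\<^sup>+s. \<integral>\<^sup>+r. 2 * indicator {s<..} r *
      (emeasure \<pi> {(x, y). x \<le> s \<and> r < y} + emeasure \<pi> {(x, y). y \<le> s \<and> r < x}) \<partial>lborel \<partial>lborel)"
proof -
  interpret \<pi>: prob_space \<pi> by fact
  interpret \<pi>l: pair_sigma_finite \<pi> "lborel :: real measure" ..
  have [measurable_cong]: "sets \<pi> = sets (borel \<Otimes>\<^sub>M borel)" by (rule sets)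
  define \<kappa> :: "real \<times> real \<Rightarrow> real \<Rightarrow> real \<Rightarrow> ennreal" where
    "\<kappa> z s r = 2 * indicator {s<..} r * (indicator {(x, y). x \<le> s \<and> r < y} z
      + indicator {(x, y). y \<le> s \<and> r < x} z)" for z s r
  \<comment> \<open>The same kernel with conditionals on \<open>fst z\<close> and
    \<open>snd z\<close>, which makes joint measurability automatic.\<close>
  have \<kappa>': "\<kappa> z s r = 2 * (if s < r then 1 else 0) * ((if fst z \<le> s \<and> r < snd z then 1 else 0)
      + (if snd z \<le> s \<and> r < fst z then 1 else 0))" for z s r
    by (auto simp: \<kappa>_def indicator_def split: prod.splits)
  have "(\<integral>\<^sup>+ (x, y). ennreal (\<bar>x - y\<bar>\<^sup>2) \<partial>\<pi>) = (\<integral>\<^sup>+z. \<integral>\<^sup>+s. \<integral>\<^sup>+r. \<kappa> z s r \<partial>lborel \<partial>lborel \<partial>\<pi>)"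
    by (intro nn_integral_cong) (auto simp only: sq_dist_eq_nn_integral \<kappa>_def split: prod.splits)
  also have "\<dots> = (\<integral>\<^sup>+s. \<integral>\<^sup>+z. \<integral>\<^sup>+r. \<kappa> z s r \<partial>lborel \<partial>\<pi> \<partial>lborel)"
    by (rule \<pi>l.Fubini'[symmetric]) (unfold \<kappa>', measurable)
  also have "\<dots> = (\<integral>\<^sup>+s. \<integral>\<^sup>+r. \<integral>\<^sup>+z. \<kappa> z s r \<partial>\<pi> \<partial>lborel \<partial>lborel)"
    by (intro nn_integral_cong \<pi>l.Fubini'[symmetric]) (unfold \<kappa>', measurable)
  also have "\<dots> = (\<integral>\<^sup>+s. \<integral>\<^sup>+r. 2 * indicator {s<..} r *
      (emeasure \<pi> {(x, y). x \<le> s \<and> r < y} + emeasure \<pi> {(x, y). y \<le> s \<and> r < x}) \<partial>lborel \<partial>lborel)"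
  proof (intro nn_integral_cong)
    fix s r :: real
    have m: "{(x, y). x \<le> s \<and> r < y} \<in> sets \<pi>" "{(x, y). y \<le> s \<and> r < x} \<in> sets \<pi>"
      unfolding sets by (rule sets_quadrants)+
    show "(\<integral>\<^sup>+z. \<kappa> z s r \<partial>\<pi>) = 2 * indicator {s<..} r *
      (emeasure \<pi> {(x, y). x \<le> s \<and> r < y} + emeasure \<pi> {(x, y). y \<le> s \<and> r < x})"
      unfolding \<kappa>_def using m by (subst nn_integral_cmult) (auto simp: nn_integral_add)
  qed
  finally show ?thesis .
qed

text \<open>Every coupling gives the quadrant \<open>x \<le> s\<close>, \<open>r < y\<close> at
  least the mass \<open>cdf P s - cdf Q r\<close>, and likewise with the roles exchanged. The image
  of the uniform distribution under both quantile functions attains these bounds for all quadrants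
  at once.\<close>

lemma W2_sq_eq_quantile_integral:
  assumes "real_distribution P" "real_distribution Q"
  shows "W2_sq P Q = (\<integral>u. (quantile (cdf P) u - quantile (cdf Q) u)\<^sup>2 \<partial>U01)"
proof -
  interpret P: real_distribution P by fact
  interpret Q: real_distribution Q by fact
  interpret U: prob_space U01 by (rule prob_space_U01)
  define q where "q = quantile (cdf P)"
  define g where "g = quantile (cdf Q)"
  have [measurable]: "q \<in> borel_measurable U01" "g \<in> borel_measurable U01"
    by (simp_all add: q_def g_def)
  define \<pi>0 where "\<pi>0 = distr U01 (borel \<Otimes>\<^sub>M borel) (\<lambda>u. (q u, g u))"
  have sets_PQ: "sets (P \<Otimes>\<^sub>M Q) = sets (borel \<Otimes>\<^sub>M borel)"
    by (intro sets_pair_measure_cong) simp_all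
  have \<pi>0: "\<pi>0 \<in> couplings P Q"
    unfolding couplings_def \<pi>0_def
    by (auto simp: sets_PQ distr_distr comp_def q_def g_def
         cong: distr_cong)
       (simp_all add: distr_cong[OF refl P.events_eq_borel refl] distr_cong[OF refl Q.events_eq_borel refl]
          P.distr_quantile Q.distr_quantile)
  have prob_\<pi>0: "prob_space \<pi>0"
    unfolding \<pi>0_def by (rule U.prob_space_distr) measurable
  have cost0: "(\<integral>\<^sup>+ (x, y). ennreal (\<bar>x - y\<bar>\<^sup>2) \<partial>\<pi>0) = (\<integral>\<^sup>+u. ennreal ((q u - g u)\<^sup>2) \<partial>U01)"
    unfolding \<pi>0_def by (subst nn_integral_distr) (auto simp: split_beta')
  \<comment> \<open>The preimage of a quadrant is an interval of levels \<open>u\<close>, so its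
    mass is the truncated difference of the distribution functions.\<close>
  have em0: "emeasure \<pi>0 {(x, y). x \<le> s \<and> r < y} = ennreal (cdf P s - cdf Q r)"
            "emeasure \<pi>0 {(x, y). y \<le> s \<and> r < x} = ennreal (cdf Q s - cdf P r)" for s r
  proof -
    have iff: "q u \<le> x \<longleftrightarrow> u \<le> cdf P x" "g u \<le> x \<longleftrightarrow> u \<le> cdf Q x"
        "x < q u \<longleftrightarrow> cdf P x < u" "x < g u \<longleftrightarrow> cdf Q x < u" if "0 < u" "u < 1" for u x
      using P.quantile_le_iff[of u x] Q.quantile_le_iff[of u x] that by (auto simp: q_def g_def)
    have "(\<lambda>u. (q u, g u)) -` {(x, y). x \<le> s \<and> r < y} \<inter> space U01 =
        {..cdf P s} \<inter> {cdf Q r<..} \<inter> {0<..<1}"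
      by (auto simp: iff)
    then show "emeasure \<pi>0 {(x, y). x \<le> s \<and> r < y} = ennreal (cdf P s - cdf Q r)"
      unfolding \<pi>0_def using sets_quadrants(1) P.cdf_bounded_prob Q.cdf_nonneg
      by (subst emeasure_distr) (simp_all only: emeasure_U01_atMost_minus_atMost, measurable)
    have "(\<lambda>u. (q u, g u)) -` {(x, y). y \<le> s \<and> r < x} \<inter> space U01 =
        {..cdf Q s} \<inter> {cdf P r<..} \<inter> {0<..<1}"
      by (auto simp: iff)
    then show "emeasure \<pi>0 {(x, y). y \<le> s \<and> r < x} = ennreal (cdf Q s - cdf P r)"
      unfolding \<pi>0_def using sets_quadrants(2) Q.cdf_bounded_prob P.cdf_nonneg
      by (subst emeasure_distr) (simp_all only: emeasure_U01_atMost_minus_atMost, measurable)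
  qed
  have opt: "(\<integral>\<^sup>+ (x, y). ennreal (\<bar>x - y\<bar>\<^sup>2) \<partial>\<pi>0) \<le> (\<integral>\<^sup>+ (x, y). ennreal (\<bar>x - y\<bar>\<^sup>2) \<partial>\<pi>)"
    if "\<pi> \<in> couplings P Q" for \<pi>
  proof -
    have sets: "sets \<pi> = sets (borel \<Otimes>\<^sub>M borel)" and dP: "distr \<pi> P fst = P" and dQ: "distr \<pi> Q snd = Q"
      using that sets_PQ by (auto simp: couplings_def)
    have sp: "space \<pi> = UNIV"
      using sets_eq_imp_space_eq[OF sets] by (simp add: space_pair_measure)
    have mfst: "fst \<in> measurable \<pi> P" and msnd: "snd \<in> measurable \<pi> Q"
      unfolding measurable_cong_sets[OF sets P.events_eq_borel] measurable_cong_sets[OF sets Q.events_eq_borel]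
      by (rule measurable_fst measurable_snd)+
    have "prob_space (distr \<pi> P fst)"
      unfolding dP by (rule P.prob_space_axioms)
    then have prob_\<pi>: "prob_space \<pi>"
      by (rule prob_space_distrD[OF mfst])
    interpret \<pi>: prob_space \<pi> by fact
    have cP: "cdf P s = measure \<pi> {(x, y). x \<le> s}" for s
      by (subst dP[symmetric]) (auto simp: cdf_def measure_distr[OF mfst] sp intro!: arg_cong2[where f=measure])
    have cQ: "cdf Q s = measure \<pi> {(x, y). y \<le> s}" for s
      by (subst dQ[symmetric]) (auto simp: cdf_def measure_distr[OF msnd] sp intro!: arg_cong2[where f=measure])
    have m: "{(x, y). x \<le> s \<and> r < y} \<in> sets \<pi>" "{(x, y). y \<le> s \<and> r < x} \<in> sets \<pi>"
        "{(x, y). x \<le> s} \<in> sets \<pi>" "{(x, y). y \<le> s} \<in> sets \<pi>" for s r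
    proof -
      have eq: "{(x, y). x \<le> s} = {..s} \<times> UNIV" "{(x, y). y \<le> s} = UNIV \<times> {..s}" by auto
      have mem: "{..s} \<times> UNIV \<in> sets \<pi>" "UNIV \<times> {..s} \<in> sets \<pi>"
        unfolding sets by (auto intro!: pair_measureI)
      show "{(x, y). x \<le> s} \<in> sets \<pi>" "{(x, y). y \<le> s} \<in> sets \<pi>"
        by (simp_all only: eq mem)
    qed (unfold sets, (rule sets_quadrants)+)
    \<comment> \<open>The half plane \<open>x \<le> s\<close> is covered by the quadrant and the
      half plane \<open>y \<le> r\<close>.\<close>
    have "cdf P s \<le> measure \<pi> ({(x, y). x \<le> s \<and> r < y} \<union> {(x, y). y \<le> r})" for s r
      unfolding cP using m by (intro \<pi>.finite_measure_mono) auto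
    also have "measure \<pi> ({(x, y). x \<le> s \<and> r < y} \<union> {(x, y). y \<le> r}) \<le>
       measure \<pi> {(x, y). x \<le> s \<and> r < y} + cdf Q r" for s r
      unfolding cQ using m by (intro measure_Un_le) auto
    finally have 1: "ennreal (cdf P s - cdf Q r) \<le> emeasure \<pi> {(x, y). x \<le> s \<and> r < y}" for s r
      by (auto simp: \<pi>.emeasure_eq_measure algebra_simps intro!: ennreal_leI)
    have "cdf Q s \<le> measure \<pi> ({(x, y). y \<le> s \<and> r < x} \<union> {(x, y). x \<le> r})" for s r
      unfolding cQ using m by (intro \<pi>.finite_measure_mono) auto
    also have "measure \<pi> ({(x, y). y \<le> s \<and> r < x} \<union> {(x, y). x \<le> r}) \<le>
       measure \<pi> {(x, y). y \<le> s \<and> r < x} + cdf P r" for s r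
      unfolding cP using m by (intro measure_Un_le) auto
    finally have 2: "ennreal (cdf Q s - cdf P r) \<le> emeasure \<pi> {(x, y). y \<le> s \<and> r < x}" for s r
      by (auto simp: \<pi>.emeasure_eq_measure algebra_simps intro!: ennreal_leI)
    have \<pi>0_sets: "sets \<pi>0 = sets (borel \<Otimes>\<^sub>M borel)" by (simp add: \<pi>0_def)
    show ?thesis
      unfolding sq_cost_eq_nn_integral[OF prob_\<pi> sets] sq_cost_eq_nn_integral[OF prob_\<pi>0 \<pi>0_sets] em0
      by (intro nn_integral_mono mult_left_mono add_mono 1 2) auto
  qed
  have "(INF \<pi>\<in>couplings P Q. \<integral>\<^sup>+ (x, y). ennreal (\<bar>x - y\<bar>\<^sup>2) \<partial>\<pi>) =
      (\<integral>\<^sup>+ (x, y). ennreal (\<bar>x - y\<bar>\<^sup>2) \<partial>\<pi>0)"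
    using \<pi>0 opt by (intro antisym INF_lower INF_greatest) auto
  then show ?thesis
    unfolding W2_sq_def cost0 by (subst integral_eq_nn_integral) (auto simp: q_def g_def)
qed


text \<open>Writing the difference as an integral over \<open>x\<close> before integrating over \<open>u\<close> turns the
  quantiles of \<open>P\<close> and \<open>P'\<close> into their distribution functions.\<close>

lemma W2_sq_diff_eq_integral:
  assumes "real_distribution P" "real_distribution P'" "real_distribution Q"
    and mP: "integrable P (\<lambda>x. x\<^sup>2)" and mP': "integrable P' (\<lambda>x. x\<^sup>2)" and mQ: "integrable Q (\<lambda>x. x\<^sup>2)"
  defines "k \<equiv> (\<lambda>x. \<integral>u. 2 * (quantile (cdf Q) u - x) * (indicator {..cdf P x} u - indicator {..cdf P' x} u) \<partial>U01)"
  shows "integrable lborel k" and "W2_sq P Q - W2_sq P' Q = (\<integral>x. k x \<partial>lborel)"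
proof -
  interpret P: real_distribution P by fact
  interpret P': real_distribution P' by fact
  interpret Q: real_distribution Q by fact
  interpret U: prob_space U01 by (rule prob_space_U01)
  interpret UL: pair_sigma_finite U01 "lborel :: real measure" ..
  define q where "q = quantile (cdf P)"
  define q' where "q' = quantile (cdf P')"
  define g where "g = quantile (cdf Q)"
  have m[measurable]: "q \<in> borel_measurable U01" "q' \<in> borel_measurable U01" "g \<in> borel_measurable U01"
    by (simp_all add: q_def q'_def g_def)
  \<comment> \<open>Two sign changes against \<open>k\<close> cancel. Comparing \<open>x\<close>
    with quantiles instead of \<open>u\<close> with distribution functions makes the kernel jointly
    measurable and easy to integrate in \<open>x\<close>.\<close>
  define K where "K = (\<lambda>(u, x). 2 * (x - g u) * ((if q' u \<le> x then 1 else 0) - (if q u \<le> x then 1 else (0::real))))"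
  have [measurable]: "K \<in> borel_measurable (U01 \<Otimes>\<^sub>M lborel)"
    unfolding K_def by measurable
  have K_iff: "K (u, x) = 2 * (g u - x) * (indicator {..cdf P x} u - indicator {..cdf P' x} u)"
    if "u \<in> {0<..<1}" for u x
    using P.quantile_le_iff[OF that] P'.quantile_le_iff[OF that]
    by (auto simp: K_def q_def q'_def indicator_def)
  have k_eq: "k x = (\<integral>u. K (u, x) \<partial>U01)" for x
    unfolding k_def by (intro Bochner_Integration.integral_cong) (auto simp: K_iff g_def)
  have sq: "integrable U01 (\<lambda>u. (q u)\<^sup>2)" "integrable U01 (\<lambda>u. (q' u)\<^sup>2)" "integrable U01 (\<lambda>u. (g u)\<^sup>2)"
    unfolding q_def q'_def g_def
    using P.integrable_quantile_sq[OF mP] P'.integrable_quantile_sq[OF mP'] Q.integrable_quantile_sq[OF mQ]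
    by auto
  have bound: "(\<integral>\<^sup>+x. ennreal (norm (K (u, x))) \<partial>lborel) \<le> ennreal (12 * ((q u)\<^sup>2 + (q' u)\<^sup>2 + (g u)\<^sup>2))" for u
  proof -
    \<comment> \<open>For fixed \<open>u\<close> the kernel is nonzero only between the two
      quantiles, hence inside the interval from \<open>- m\<close> to \<open>m\<close>. The constant
      12 below is 4 times the 3 from bounding the square of a sum of three terms.\<close>
    define m where "m = \<bar>q u\<bar> + \<bar>q' u\<bar>"
    have m0: "m \<ge> 0" by (simp add: m_def)
    have "(\<integral>\<^sup>+x. ennreal (norm (K (u, x))) \<partial>lborel) \<le>
        (\<integral>\<^sup>+x. ennreal (2 * (m + \<bar>g u\<bar>)) * indicator {-m..m} x \<partial>lborel)"
    proof (intro nn_integral_mono)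
      fix x
      have "norm (K (u, x)) \<le> 2 * (m + \<bar>g u\<bar>) * indicator {-m..m} x"
        by (auto simp: K_def m_def indicator_def abs_mult)
      from ennreal_leI[OF this]
      show "ennreal (norm (K (u, x))) \<le> ennreal (2 * (m + \<bar>g u\<bar>)) * indicator {-m..m} x"
        by (cases "x \<in> {-m..m}") (simp_all only: indicator_simps mult_1_right mult_zero_right ennreal_0 not_False_eq_True)
    qed
    also have "\<dots> = ennreal (2 * (m + \<bar>g u\<bar>)) * ennreal (2 * m)"
      using m0 by (subst nn_integral_cmult_indicator) auto
    also have "\<dots> = ennreal (2 * (m + \<bar>g u\<bar>) * (2 * m))"
      using m0 by (subst ennreal_mult) auto
    also have "\<dots> \<le> ennreal (12 * ((q u)\<^sup>2 + (q' u)\<^sup>2 + (g u)\<^sup>2))"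
    proof (rule ennreal_leI)
      have "2 * (m + \<bar>g u\<bar>) * (2 * m) \<le> 4 * (m + \<bar>g u\<bar>)\<^sup>2"
        using m0 by (simp add: power2_eq_square algebra_simps)
      also have "(m + \<bar>g u\<bar>)\<^sup>2 \<le> 3 * ((q u)\<^sup>2 + (q' u)\<^sup>2 + (g u)\<^sup>2)"
      proof -
        have "0 \<le> (\<bar>q u\<bar> - \<bar>q' u\<bar>)\<^sup>2 + (\<bar>q u\<bar> - \<bar>g u\<bar>)\<^sup>2 + (\<bar>q' u\<bar> - \<bar>g u\<bar>)\<^sup>2"
          by simp
        then show ?thesis
          unfolding m_def by (simp add: power2_eq_square algebra_simps flip: abs_mult)
      qed
      finally show "2 * (m + \<bar>g u\<bar>) * (2 * m) \<le> 12 * ((q u)\<^sup>2 + (q' u)\<^sup>2 + (g u)\<^sup>2)"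
        by simp
    qed
    finally show ?thesis .
  qed
  have int_K: "integrable (U01 \<Otimes>\<^sub>M lborel) K"
  proof (rule integrableI_bounded)
    have "(\<integral>\<^sup>+z. ennreal (norm (K z)) \<partial>(U01 \<Otimes>\<^sub>M lborel)) = (\<integral>\<^sup>+u. \<integral>\<^sup>+x. ennreal (norm (K (u, x))) \<partial>lborel \<partial>U01)"
      by (rule lborel.nn_integral_fst[symmetric]) measurable
    also have "\<dots> \<le> (\<integral>\<^sup>+u. ennreal (12 * ((q u)\<^sup>2 + (q' u)\<^sup>2 + (g u)\<^sup>2)) \<partial>U01)"
      by (intro nn_integral_mono bound)
    also have "\<dots> < \<infinity>"
    proof -
      have "integrable U01 (\<lambda>u. 12 * ((q u)\<^sup>2 + (q' u)\<^sup>2 + (g u)\<^sup>2))"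
        using sq by auto
      from nn_integral_eq_integral[OF this] show ?thesis by auto
    qed
    finally show "(\<integral>\<^sup>+z. ennreal (norm (K z)) \<partial>(U01 \<Otimes>\<^sub>M lborel)) < \<infinity>" .
  qed measurable
  have int_K': "integrable (U01 \<Otimes>\<^sub>M lborel) (\<lambda>(u, x). K (u, x))"
    using int_K by simp
  show "integrable lborel k"
    using UL.integrable_snd[OF int_K'] by (simp add: k_eq[abs_def])
  \<comment> \<open>An integral of \<open>2 * (x - g u)\<close> between the quantiles, with its sign
    determined by their order.\<close>
  have inner: "(\<integral>x. K (u, x) \<partial>lborel) = (q u - g u)\<^sup>2 - (q' u - g u)\<^sup>2" for u
  proof -
    have FTC: "(\<integral>x. (2 * (x - g u)) * indicator {A..B} x \<partial>lborel) = (B - g u)\<^sup>2 - (A - g u)\<^sup>2" if "A \<le> B" for A B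
      using that
      by (intro integral_FTC_Icc_real[of A B "\<lambda>x. (x - g u)\<^sup>2" "\<lambda>x. 2 * (x - g u)"])
        (auto intro!: derivative_eq_intros continuous_intros)
    show ?thesis
    proof (cases "q' u \<le> q u")
      case True
      have "(\<integral>x. K (u, x) \<partial>lborel) = (\<integral>x. (2 * (x - g u)) * indicator {q' u..q u} x \<partial>lborel)"
        using AE_lborel_singleton[of "q u"] True
        by (intro integral_cong_AE) (auto simp: K_def indicator_def elim!: eventually_mono)
      then show ?thesis using FTC[OF True] by simp
    next
      case False
      have "(\<integral>x. K (u, x) \<partial>lborel) = (\<integral>x. - ((2 * (x - g u)) * indicator {q u..q' u} x) \<partial>lborel)"
        using AE_lborel_singleton[of "q' u"] False
        by (intro integral_cong_AE) (auto simp: K_def indicator_def elim!: eventually_mono)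
      then show ?thesis using FTC[of "q u" "q' u"] False by simp
    qed
  qed
  have int_sq: "integrable U01 (\<lambda>u. (f u - g u)\<^sup>2)"
    if [measurable]: "f \<in> borel_measurable U01" and "integrable U01 (\<lambda>u. (f u)\<^sup>2)" for f
  proof (rule Bochner_Integration.integrable_bound)
    show "integrable U01 (\<lambda>u. 2 * ((f u)\<^sup>2 + (g u)\<^sup>2))"
      using that sq by auto
    have "(f u - g u)\<^sup>2 \<le> 2 * ((f u)\<^sup>2 + (g u)\<^sup>2)" for u
      using zero_le_power2[of "f u + g u"] by (simp add: power2_eq_square algebra_simps)
    then show "AE u in U01. norm ((f u - g u)\<^sup>2) \<le> norm (2 * ((f u)\<^sup>2 + (g u)\<^sup>2))"
      by (auto intro!: AE_I2 order_trans[OF _ abs_ge_self])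
  qed measurable
  have "W2_sq P Q - W2_sq P' Q = (\<integral>u. (q u - g u)\<^sup>2 \<partial>U01) - (\<integral>u. (q' u - g u)\<^sup>2 \<partial>U01)"
    using assms by (simp add: W2_sq_eq_quantile_integral q_def q'_def g_def)
  also have "\<dots> = (\<integral>u. (q u - g u)\<^sup>2 - (q' u - g u)\<^sup>2 \<partial>U01)"
    using int_sq m sq by simp
  also have "\<dots> = (\<integral>u. (\<integral>x. K (u, x) \<partial>lborel) \<partial>U01)"
    by (simp add: inner)
  also have "\<dots> = (\<integral>x. (\<integral>u. K (u, x) \<partial>U01) \<partial>lborel)"
    by (rule UL.Fubini_integral[symmetric, OF int_K'])
  finally show "W2_sq P Q - W2_sq P' Q = (\<integral>x. k x \<partial>lborel)"
    by (simp add: k_eq)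
qed

section \<open>Distribution functions with a positive density on an interval\<close>

locale positive_density =
  fixes a b :: ereal and p :: "real \<Rightarrow> real" and M :: "real measure"
  assumes meas [measurable]: "p \<in> borel_measurable borel"
    and M_eq: "M = density lborel (\<lambda>x. ennreal (p x))"
    and prob: "prob_space M"
    and pos: "x \<in> einterval a b \<Longrightarrow> p x > 0"
    and zero: "x \<notin> einterval a b \<Longrightarrow> p x = 0"
begin

lemma nonneg: "p x \<ge> 0"
  using pos[of x] zero[of x] by (cases "x \<in> einterval a b") auto

sublocale prob_space M by (rule prob)
sublocale real_distribution M
  by standard (auto simp: M_eq)

lemma integrable_density: "integrable lborel p"
proof (rule integrableI_nonneg)
  have "(\<integral>\<^sup>+x. ennreal (p x) \<partial>lborel) = emeasure M (space M)"
    by (simp add: M_eq emeasure_density)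
  then show "(\<integral>\<^sup>+x. ennreal (p x) \<partial>lborel) < \<infinity>"
    by (simp only: emeasure_space_1) simp
qed (auto simp: nonneg)

lemma cdf_eq: "cdf M x = (LBINT y:{..x}. p y)"
proof -
  have "emeasure M {..x} = (\<integral>\<^sup>+y. ennreal (p y * indicator {..x} y) \<partial>lborel)"
    unfolding M_eq by (subst emeasure_density) (auto intro!: nn_integral_cong simp: indicator_def)
  then have "cdf M x = (\<integral>y. p y * indicator {..x} y \<partial>lborel)"
    unfolding cdf_def measure_def
    by (subst integral_eq_nn_integral) (auto simp: nonneg)
  then show ?thesis by (simp add: set_lebesgue_integral_def mult.commute)
qed

lemma measure_Ioo_pos:
  assumes "c < d" "{c<..<d} \<subseteq> einterval a b"
  shows "measure M {c<..<d} > 0"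
proof (rule ccontr)
  assume "\<not> ?thesis"
  then have "emeasure M {c<..<d} = 0"
    by (simp add: emeasure_eq_measure not_less measure_le_0_iff)
  then have "{c<..<d} \<in> null_sets M"
    by (simp add: null_sets_def)
  then have "AE x in lborel. x \<in> {c<..<d} \<longrightarrow> p x = 0"
    unfolding M_eq by (subst (asm) null_sets_density_iff) (auto simp: nonneg antisym ennreal_eq_0_iff)
  then have "AE x in lborel. x \<notin> {c<..<d}"
    by (rule eventually_mono) (use assms pos in force)
  then have "{c<..<d} \<in> null_sets lborel"
    by (subst AE_iff_null_sets) auto
  then show False using assms by (simp add: null_sets_def)
qed

lemma cdf_strict_mono:
  assumes "x \<in> einterval a b" "y \<in> einterval a b" "x < y"
  shows "cdf M x < cdf M y"
proof -
  have "{x<..<y} \<subseteq> einterval a b"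
    using assms by (auto simp: einterval_iff) (meson less_trans ereal_less_eq less_ereal.simps)+
  then have "0 < measure M {x<..<y}" using assms(3) by (intro measure_Ioo_pos)
  also have "\<dots> \<le> measure M {x<..y}" by (intro finite_measure_mono) auto
  also have "\<dots> = cdf M y - cdf M x" using assms(3) by (simp add: cdf_diff_eq)
  finally show ?thesis by simp
qed

lemma cdf_bounds:
  assumes "x \<in> einterval a b"
  shows "0 < cdf M x" "cdf M x < 1"
proof -
  obtain e where e: "e > 0" "ball x e \<subseteq> einterval a b"
    using assms open_einterval openE by blast
  then have 1: "x - e/2 \<in> einterval a b" "x + e/2 \<in> einterval a b"
    by (auto simp: dist_real_def subset_iff)
  show "0 < cdf M x"
    using cdf_strict_mono[OF 1(1) assms] e cdf_nonneg[of "x - e/2"] by simp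
  show "cdf M x < 1"
    using cdf_strict_mono[OF assms 1(2)] e cdf_bounded_prob[of "x + e/2"] by simp
qed

text \<open>The value depends on the interval alone and not on the density, so differences between
  members of a family vanish off the interval.\<close>

lemma cdf_outside:
  assumes "x \<notin> einterval a b"
  shows "cdf M x = (if ereal x \<le> a then 0 else 1)"
proof (cases "ereal x \<le> a")
  case True
  have "p y = 0" if "y \<le> x" for y
  proof (rule zero)
    have "ereal y \<le> a" using that True by (metis ereal_less_eq(3) order.trans)
    then show "y \<notin> einterval a b" by (auto simp: einterval_iff not_less)
  qed
  then have "(LBINT y:{..x}. p y) = (LBINT y:{..x}. 0)"
    by (intro set_lebesgue_integral_cong) auto
  then show ?thesis using True by (simp add: cdf_eq)
next
  case False
  then have b: "b \<le> ereal x" using assms by (auto simp: einterval_iff)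
  have "p y = 0" if "x \<le> y" for y
  proof (rule zero)
    have "b \<le> ereal y" using that b by (metis ereal_less_eq(3) order.trans)
    then show "y \<notin> einterval a b" by (auto simp: einterval_iff not_less)
  qed
  then have "emeasure M {x<..} = 0"
    unfolding M_eq by (subst emeasure_density) (auto simp: nn_integral_0_iff_AE indicator_def)
  moreover have "measure M (space M) - measure M {x<..} = cdf M x"
    unfolding cdf_def by (subst finite_measure_compl[symmetric]) (auto intro!: arg_cong[where f="measure M"])
  ultimately show ?thesis using False prob_space by (simp add: measure_def)
qed

lemma isCont_cdf_density: "isCont (cdf M) x"
proof -
  have "emeasure M {x} = 0"
    unfolding M_eq by (subst emeasure_density)
      (auto simp: nn_integral_0_iff_AE indicator_def intro: eventually_mono[OF AE_lborel_singleton[of x]])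
  then show ?thesis by (simp add: isCont_cdf measure_def)
qed

text \<open>One inequality is the Galois connection; the other is the limit from the left, where all
  values are below \<open>u\<close>. The quantile lies in the interval because outside it the
  distribution function is 0 or 1.\<close>

lemma cdf_quantile:
  assumes "u \<in> {0<..<1}"
  shows "cdf M (quantile (cdf M) u) = u" "quantile (cdf M) u \<in> einterval a b"
proof -
  let ?x = "quantile (cdf M) u"
  have ge: "u \<le> cdf M ?x" using quantile_le_iff[OF assms, of ?x] by simp
  have less: "cdf M y < u" if "y < ?x" for y
    using quantile_le_iff[OF assms, of y] that by linarith
  have "(cdf M \<longlongrightarrow> cdf M ?x) (at_left ?x)"
    using isCont_cdf_density[of ?x] by (simp add: isCont_def filterlim_at_split)
  then have "cdf M ?x \<le> u"
    by (rule tendsto_upperbound) (auto simp: eventually_at_filter intro!: less_imp_le[OF less] always_eventually)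
  with ge show eq: "cdf M ?x = u" by simp
  show "?x \<in> einterval a b"
    using cdf_outside[of ?x] assms unfolding eq by (force split: if_splits)
qed

text \<open>A jump of the quantile function would be a flat piece of the distribution function,
  which positivity of the density excludes. The lower estimate follows from the Galois connection,
  the upper one from strict monotonicity.\<close>

lemma isCont_quantile:
  assumes u: "u \<in> {0<..<1}"
  shows "isCont (quantile (cdf M)) u"
  unfolding isCont_def
proof (rule order_tendstoI)
  have ev: "\<forall>\<^sub>F w in at u. w \<in> {0<..<1}"
    using u by (intro eventually_at_in_open') auto
  fix l assume "l < quantile (cdf M) u"
  then have "cdf M l < u" using quantile_le_iff[OF u, of l] by linarith
  then have "\<forall>\<^sub>F w in at u. w \<in> {cdf M l<..}"
    by (intro eventually_at_in_open') auto
  with ev show "\<forall>\<^sub>F w in at u. l < quantile (cdf M) w"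
    by eventually_elim (use quantile_le_iff in \<open>auto simp: not_le[symmetric]\<close>)
next
  have ev: "\<forall>\<^sub>F w in at u. w \<in> {0<..<1}"
    using u by (intro eventually_at_in_open') auto
  fix r assume r: "quantile (cdf M) u < r"
  let ?x = "quantile (cdf M) u"
  obtain e where e: "e > 0" "ball ?x e \<subseteq> einterval a b"
    using cdf_quantile(2)[OF u] open_einterval openE by blast
  \<comment> \<open>A point above the quantile and below \<open>r\<close> that still lies in the
    interval, where strict monotonicity is available.\<close>
  define y where "y = ?x + min e (r - ?x) / 2"
  have y: "?x < y" "y < r" using e(1) r min.cobounded2[of e "r - ?x"] by (auto simp: y_def min_less_iff_conj simp del: min.cobounded2)
  have "y \<in> einterval a b"
    using e r by (intro subsetD[OF e(2)]) (auto simp: y_def dist_real_def)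
  then have "u < cdf M y"
    using cdf_strict_mono[OF cdf_quantile(2)[OF u] _ y(1)] cdf_quantile(1)[OF u] by simp
  then have "\<forall>\<^sub>F w in at u. w \<in> {..<cdf M y}"
    by (intro eventually_at_in_open') auto
  with ev show "\<forall>\<^sub>F w in at u. quantile (cdf M) w < r"
  proof eventually_elim
    case (elim w)
    then have "quantile (cdf M) w \<le> y" using quantile_le_iff[of w y] by simp
    then show ?case using y(2) by simp
  qed
qed

end

section \<open>Differentiating the Wasserstein distance twice\<close>

locale density_family =
  fixes a b :: ereal and \<Theta> :: "(real^'d::finite) set" and P :: "real^'d \<Rightarrow> real measure"
    and p F :: "real^'d \<Rightarrow> real \<Rightarrow> real" and \<theta> :: "real^'d"
  assumes open_\<Theta>: "open \<Theta>" and \<theta>: "\<theta> \<in> \<Theta>"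
    and density: "v \<in> \<Theta> \<Longrightarrow> positive_density a b (p v) (P v)"
    and moment: "v \<in> \<Theta> \<Longrightarrow> integrable (P v) (\<lambda>x. x\<^sup>2)"
    and F: "F v x = (LBINT y:{..x}. p v y)"
    and F_hess: "v \<in> \<Theta> \<Longrightarrow> x \<in> einterval a b \<Longrightarrow> twice_differentiable_at (\<lambda>v. F v x) v"
begin

abbreviation X :: "real set" where "X \<equiv> einterval a b"
abbreviation q :: "real \<Rightarrow> real" where "q \<equiv> quantile (F \<theta>)"
abbreviation W :: "real^'d \<Rightarrow> real" where "W \<equiv> \<lambda>v. W2_sq (P v) (P \<theta>)"

text \<open>Half the integrand of the \<open>j\<close>-th partial derivative of \<open>W\<close>.
  The function dominated in condition (ii) is its \<open>i\<close>-th partial derivative.\<close>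

definition g :: "'d \<Rightarrow> real^'d \<Rightarrow> real \<Rightarrow> real" where
  "g j v x = (q (F v x) - x) * partial j (\<lambda>v. F v x) v"

definition H :: "real \<Rightarrow> real \<Rightarrow> real" where
  "H x r = (\<integral>u. 2 * (q u - x) * indicator {..r} u \<partial>U01)"

lemma F_eq_cdf: "v \<in> \<Theta> \<Longrightarrow> F v = cdf (P v)"
  using positive_density.cdf_eq[OF density] by (auto simp: F)

lemma F_bounds: "v \<in> \<Theta> \<Longrightarrow> x \<in> X \<Longrightarrow> F v x \<in> {0<..<1}"
  using positive_density.cdf_bounds[OF density] by (simp add: F_eq_cdf)

lemma isCont_q: "u \<in> {0<..<1} \<Longrightarrow> isCont q u"
  using positive_density.isCont_quantile[OF density[OF \<theta>]] by (simp add: F_eq_cdf \<theta>)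

lemma real_distribution_P: "v \<in> \<Theta> \<Longrightarrow> real_distribution (P v)"
proof -
  assume "v \<in> \<Theta>"
  then interpret positive_density a b "p v" "P v" by (rule density)
  show ?thesis ..
qed

lemma integrable_q: "integrable U01 q"
  using real_distribution.integrable_quantile[OF real_distribution_P moment, OF \<theta> \<theta>] by (simp add: F_eq_cdf \<theta>)

lemma F_differentiable:
  assumes "v \<in> \<Theta>" "x \<in> X"
  shows "(\<lambda>v. F v x) differentiable (at v)" "partial j (\<lambda>v. F v x) differentiable (at v)"
  using F_hess[OF assms] has_hessian_imp_differentiable has_hessian_imp_has_derivative_partial
  unfolding twice_differentiable_at_def differentiable_def by blast+

lemma isCont_q_F:
  assumes "v \<in> \<Theta>" "x \<in> X"
  shows "isCont (\<lambda>v. q (F v x)) v"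
  using isCont_o2[OF differentiable_imp_continuous_within[OF F_differentiable(1)[OF assms]] isCont_q[OF F_bounds[OF assms]]] .

lemma isCont_g:
  assumes "v \<in> \<Theta>" "x \<in> X"
  shows "isCont (\<lambda>v. g j v x) v"
  unfolding g_def using isCont_q_F[OF assms] differentiable_imp_continuous_within[OF F_differentiable(2)[OF assms]]
  by (intro continuous_intros) auto

lemma measurable_F: "v \<in> \<Theta> \<Longrightarrow> F v \<in> borel_measurable borel"
  by (rule borel_measurable_mono) 
    (simp add: F_eq_cdf monoI finite_borel_measure.cdf_nondecreasing
      real_distribution.axioms real_distribution.finite_borel_measure_M real_distribution_P)

text \<open>On \<open>X\<close> the first factor is continuous, because \<open>F v\<close> stays in
  the open unit interval there; the second is a limit of difference quotients.\<close>

lemma measurable_g: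
  assumes v: "v \<in> \<Theta>"
  shows "(\<lambda>x. indicator X x * g j v x) \<in> borel_measurable borel"
proof -
  interpret v: positive_density a b "p v" "P v" by (rule density[OF v])
  have "continuous_on X (\<lambda>x. q (F v x) - x)"
    using isCont_o2[OF v.isCont_cdf_density isCont_q] F_bounds[OF v]
    by (intro continuous_at_imp_continuous_on ballI continuous_intros) (auto simp: F_eq_cdf[OF v])
  then have 1: "(\<lambda>x. indicator X x *\<^sub>R (q (F v x) - x)) \<in> borel_measurable borel"
    by (intro borel_measurable_continuous_on_indicator) auto
  have 2: "(\<lambda>x. indicator X x * partial j (\<lambda>v. F v x) v) \<in> borel_measurable borel"
  proof (rule borel_measurable_partial[OF open_\<Theta> v])
    show "(\<lambda>x. indicator X x * F w x) \<in> borel_measurable borel" if "w \<in> \<Theta>" for w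
      by (intro borel_measurable_times borel_measurable_indicator measurable_F that) simp
    show "has_partial j (\<lambda>v. F v x) v" if "x \<in> X" for x
      by (intro differentiable_imp_has_partial F_differentiable v that)
  qed
  have "(\<lambda>x. (indicator X x *\<^sub>R (q (F v x) - x)) * (indicator X x * partial j (\<lambda>v. F v x) v)) \<in> borel_measurable borel"
    by (rule borel_measurable_times[OF 1 2])
  also have "(\<lambda>x. (indicator X x *\<^sub>R (q (F v x) - x)) * (indicator X x * partial j (\<lambda>v. F v x) v)) =
     (\<lambda>x. indicator X x * g j v x)"
    by (auto simp: g_def indicator_def)
  finally show ?thesis .
qed

text \<open>Continuity of \<open>q\<close> gives the derivative at every level \<open>r\<close>. The
  mean value theorem along a coordinate line with \<open>x\<close> fixed needs all levels, not
  almost all.\<close>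

lemma DERIV_H:
  assumes r: "r \<in> {0<..<1}"
  shows "(H x has_real_derivative 2 * (q r - x)) (at r)"
proof -
  interpret U: prob_space U01 by (rule prob_space_U01)
  define f where "f = (\<lambda>u. indicator {0<..<1} u *\<^sub>R (2 * (q u - x)))"
  have "integrable U01 (\<lambda>u. 2 * (q u - x))"
    using integrable_q by simp
  then have f: "integrable lborel f"
    unfolding f_def by (subst (asm) integrable_restrict_space) auto
  have H_eq: "H x = (\<lambda>r. LBINT u:{..r}. f u)"
    unfolding H_def f_def set_lebesgue_integral_def
    by (subst integral_restrict_space) (auto intro!: Bochner_Integration.integral_cong simp: indicator_def)
  have "isCont f r"
  proof -
    have "isCont (\<lambda>u. 2 * (q u - x)) r"
      using isCont_q[OF r] by (intro continuous_intros) auto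
    moreover have "\<forall>\<^sub>F u in nhds r. u \<in> {0<..<1}"
      using r by (intro eventually_nhds_in_open) auto
    then have "\<forall>\<^sub>F u in nhds r. f u = 2 * (q u - x)"
      by eventually_elim (simp add: f_def)
    then have "isCont f r \<longleftrightarrow> isCont (\<lambda>u. 2 * (q u - x)) r"
      by (rule isCont_cong)
    ultimately show ?thesis by simp
  qed
  from DERIV_set_integral_atMost[OF f this] show ?thesis
    using r by (simp add: H_eq) (simp add: f_def)
qed

section \<open>The first derivative of the squared distance\<close>

text \<open>Integrability of \<open>q\<close> allows the inner integral of the Fubini formula to be
  split into two values of \<open>H x\<close>. Off \<open>X\<close> the two distribution functions
  agree, which explains the indicator.\<close>

lemma W_diff_eq_integral:
  assumes "v \<in> \<Theta>" "w \<in> \<Theta>"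
  shows "integrable lborel (\<lambda>x. indicator X x * (H x (F v x) - H x (F w x)))"
    and "W v - W w = (\<integral>x. indicator X x * (H x (F v x) - H x (F w x)) \<partial>lborel)"
proof -
  interpret U: prob_space U01 by (rule prob_space_U01)
  have eq: "(\<integral>u. 2 * (q u - x) * (indicator {..F v x} u - indicator {..F w x} u) \<partial>U01) =
     indicator X x * (H x (F v x) - H x (F w x))" for x
  proof (cases "x \<in> X")
    case True
    have "integrable U01 (\<lambda>u. 2 * (q u - x) * indicator {..r} u)" for r
    proof (rule Bochner_Integration.integrable_bound)
      show "integrable U01 (\<lambda>u. 2 * (q u - x))" using integrable_q by simp
      have [measurable]: "q \<in> borel_measurable U01" using integrable_q by simp
      have [measurable]: "(indicator {..r} :: real \<Rightarrow> real) \<in> borel_measurable U01"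
        by (rule measurable_restrict_space1) simp
      show "(\<lambda>u. 2 * (q u - x) * indicator {..r} u) \<in> borel_measurable U01" by measurable
    qed (auto simp: indicator_def)
    then show ?thesis
      using True by (simp add: H_def right_diff_distrib)
  next
    case False
    then have "F v x = F w x"
      using positive_density.cdf_outside[OF density] assms by (simp add: F_eq_cdf)
    then show ?thesis using False by simp
  qed
  note * = W2_sq_diff_eq_integral[OF real_distribution_P real_distribution_P real_distribution_P
      moment moment moment, OF assms \<theta> assms \<theta>]
  show "integrable lborel (\<lambda>x. indicator X x * (H x (F v x) - H x (F w x)))"
    using *(1) unfolding F_eq_cdf[OF assms(1), symmetric] F_eq_cdf[OF assms(2), symmetric]
      F_eq_cdf[OF \<theta>, symmetric] eq .
  show "W v - W w = (\<integral>x. indicator X x * (H x (F v x) - H x (F w x)) \<partial>lborel)"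
    using *(2) unfolding F_eq_cdf[OF assms(1), symmetric] F_eq_cdf[OF assms(2), symmetric]
      F_eq_cdf[OF \<theta>, symmetric] eq .
qed

lemma DERIV_H_F:
  assumes "v + s *\<^sub>R axis j 1 \<in> \<Theta>" "x \<in> X"
  shows "((\<lambda>s. H x (F (v + s *\<^sub>R axis j 1) x)) has_real_derivative 2 * g j (v + s *\<^sub>R axis j 1) x) (at s)"
proof -
  have "((\<lambda>s. F (v + s *\<^sub>R axis j 1) x) has_real_derivative partial j (\<lambda>v. F v x) (v + s *\<^sub>R axis j 1)) (at s)"
    by (intro has_partial_DERIV[of j "\<lambda>v. F v x"] differentiable_imp_has_partial F_differentiable assms)
  from DERIV_chain2[OF DERIV_H[OF F_bounds[OF assms]] this] show ?thesis
    by (simp only: g_def mult.assoc)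
qed

text \<open>The mean value theorem in direction \<open>j\<close> replaces difference quotients of \<open>W\<close> by values of \<open>g\<close>. This also
  yields the integrability of \<open>g\<close> itself, about which condition (ii) says nothing directly.\<close>

lemma partial_W:
  assumes r: "ball t r \<subseteq> \<Theta>" and M: "integrable lborel M" "\<And>x. 0 \<le> M x"
    and lip: "AE x in lborel. x \<in> X \<longrightarrow> (\<forall>v s. v \<in> ball t r \<longrightarrow> v + s *\<^sub>R axis j 1 \<in> ball t r \<longrightarrow>
      \<bar>g j (v + s *\<^sub>R axis j 1) x - g j v x\<bar> \<le> \<bar>s\<bar> * M x)"
    and v: "v \<in> ball t r"
  shows "integrable lborel (\<lambda>x. indicator X x * g j v x)"
    and "partial j W v = 2 * (\<integral>x. indicator X x * g j v x \<partial>lborel)"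
proof -
  obtain e where e: "e > 0" "ball v e \<subseteq> ball t r"
    using v open_ball openE by blast
  have in_ball: "v + s *\<^sub>R axis j 1 \<in> ball t r" if "\<bar>s\<bar> < e" for s
    using that by (intro subsetD[OF e(2)]) (simp add: dist_norm)
  have v\<Theta>: "v \<in> \<Theta>" using v r by auto
  define k where "k = (\<lambda>s x. indicator X x * (H x (F (v + s *\<^sub>R axis j 1) x) - H x (F v x)))"
  have k_int: "integrable lborel (k s)" and k_W: "W (v + s *\<^sub>R axis j 1) - W v = (\<integral>x. k s x \<partial>lborel)" if "\<bar>s\<bar> < e" for s
    using W_diff_eq_integral[of "v + s *\<^sub>R axis j 1" v] in_ball[OF that] r v\<Theta> by (auto simp: k_def)
  \<comment> \<open>First-order expansion with a quadratic error: the mean value theorem yields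
    \<open>2 * s * g\<close> at an intermediate point, and the Lipschitz bound moves that point back
    to \<open>v\<close>.\<close>
  have est: "AE x in lborel. \<bar>k s x - 2 * s * (indicator X x * g j v x)\<bar> \<le> 2 * s\<^sup>2 * M x" if s: "\<bar>s\<bar> < e" for s
    using lip
  proof eventually_elim
    case (elim x)
    show ?case
    proof (cases "x \<in> X")
      case True
      have D: "((\<lambda>s. H x (F (v + s *\<^sub>R axis j 1) x)) has_real_derivative 2 * g j (v + \<sigma> *\<^sub>R axis j 1) x) (at \<sigma>)"
        if "\<bar>\<sigma>\<bar> \<le> \<bar>s\<bar>" for \<sigma>
        using in_ball[of \<sigma>] that s r True by (intro DERIV_H_F) auto
      obtain \<xi> where \<xi>: "\<bar>\<xi>\<bar> \<le> \<bar>s\<bar>" "k s x = s * (2 * g j (v + \<xi> *\<^sub>R axis j 1) x)"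
      proof (cases s "0 :: real" rule: linorder_cases)
        case less
        obtain z where "s < z" "z < 0" "H x (F (v + 0 *\<^sub>R axis j 1) x) - H x (F (v + s *\<^sub>R axis j 1) x) =
            (0 - s) * (2 * g j (v + z *\<^sub>R axis j 1) x)"
          using MVT2[OF less, of "\<lambda>s. H x (F (v + s *\<^sub>R axis j 1) x)" "\<lambda>z. 2 * g j (v + z *\<^sub>R axis j 1) x"] D by auto
        then show ?thesis using that[of z] True by (simp add: k_def)
      next
        case equal
        then show ?thesis using that[of 0] by (simp add: k_def)
      next
        case greater
        obtain z where "0 < z" "z < s" "H x (F (v + s *\<^sub>R axis j 1) x) - H x (F (v + 0 *\<^sub>R axis j 1) x) =
            (s - 0) * (2 * g j (v + z *\<^sub>R axis j 1) x)"
          using MVT2[OF greater, of "\<lambda>s. H x (F (v + s *\<^sub>R axis j 1) x)" "\<lambda>z. 2 * g j (v + z *\<^sub>R axis j 1) x"] D by auto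
        then show ?thesis using that[of z] True by (simp add: k_def)
      qed
      have "\<bar>g j (v + \<xi> *\<^sub>R axis j 1) x - g j v x\<bar> \<le> \<bar>\<xi>\<bar> * M x"
        using elim True v in_ball[of \<xi>] \<xi>(1) s by simp
      also have "\<dots> \<le> \<bar>s\<bar> * M x" using \<xi>(1) M(2) by (rule mult_right_mono)
      finally have "2 * \<bar>s\<bar> * \<bar>g j (v + \<xi> *\<^sub>R axis j 1) x - g j v x\<bar> \<le> 2 * \<bar>s\<bar> * (\<bar>s\<bar> * M x)"
        by (rule mult_left_mono) simp
      moreover have "k s x - 2 * s * (indicator X x * g j v x) = 2 * s * (g j (v + \<xi> *\<^sub>R axis j 1) x - g j v x)"
        using True by (simp add: \<xi>(2) right_diff_distrib)
      moreover have "2 * \<bar>s\<bar> * (\<bar>s\<bar> * M x) = 2 * s\<^sup>2 * M x"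
        by (simp add: power2_eq_square flip: abs_mult mult.assoc)
      ultimately show ?thesis by (simp add: abs_mult)
    next
      case False
      then show ?thesis using M(2)[of x] by (simp add: k_def)
    qed
  qed
  show int_g: "integrable lborel (\<lambda>x. indicator X x * g j v x)"
  proof -
    \<comment> \<open>A single nonzero step suffices: the estimate bounds a multiple of
      \<open>g\<close> by the integrable \<open>k s\<close> and \<open>M\<close>.\<close>
    define s where "s = e / 2"
    have s: "s > 0" "\<bar>s\<bar> < e" using e by (auto simp: s_def)
    have "integrable lborel (\<lambda>x. 2 * s * (indicator X x * g j v x))"
    proof (rule Bochner_Integration.integrable_bound)
      show "integrable lborel (\<lambda>x. \<bar>k s x\<bar> + 2 * s\<^sup>2 * M x)"
        using k_int[OF s(2)] M(1) by auto
      show "(\<lambda>x. 2 * s * (indicator X x * g j v x)) \<in> borel_measurable lborel"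
        using measurable_g[OF v\<Theta>, of j] by (intro borel_measurable_times[OF borel_measurable_const]) simp
      show "AE x in lborel. norm (2 * s * (indicator X x * g j v x)) \<le> norm (\<bar>k s x\<bar> + 2 * s\<^sup>2 * M x)"
        using est[OF s(2)]
      proof eventually_elim
        case (elim x)
        have "0 \<le> 2 * s\<^sup>2 * M x" using M(2) by simp
        then show ?case using elim unfolding real_norm_def by linarith
      qed
    qed
    then show ?thesis using s by simp
  qed
  let ?J = "\<integral>x. indicator X x * g j v x \<partial>lborel"
  have "((\<lambda>s. (W (v + s *\<^sub>R axis j 1) - W v) / s - 2 * ?J) \<longlongrightarrow> 0) (at 0)"
  proof (rule Lim_null_comparison)
    show "((\<lambda>s. 2 * \<bar>s\<bar> * (\<integral>x. M x \<partial>lborel)) \<longlongrightarrow> 0) (at 0)"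
      by (auto intro!: tendsto_eq_intros)
    show "\<forall>\<^sub>F s in at 0. norm ((W (v + s *\<^sub>R axis j 1) - W v) / s - 2 * ?J) \<le> 2 * \<bar>s\<bar> * (\<integral>x. M x \<partial>lborel)"
      unfolding eventually_at
    proof (intro exI[of _ e] conjI e ballI impI)
      fix s :: real assume "s \<noteq> 0 \<and> dist s 0 < e"
      then have s: "s \<noteq> 0" "\<bar>s\<bar> < e" by auto
      have "W (v + s *\<^sub>R axis j 1) - W v - 2 * s * ?J = (\<integral>x. k s x - 2 * s * (indicator X x * g j v x) \<partial>lborel)"
        using int_g k_int[OF s(2)] by (simp add: k_W[OF s(2)])
      also have "\<bar>\<dots>\<bar> \<le> (\<integral>x. 2 * s\<^sup>2 * M x \<partial>lborel)"
        using est[OF s(2)] k_int[OF s(2)] int_g M(1)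
        by (intro order_trans[OF integral_abs_bound integral_mono_AE]) auto
      finally have "\<bar>W (v + s *\<^sub>R axis j 1) - W v - 2 * s * ?J\<bar> \<le> 2 * s\<^sup>2 * (\<integral>x. M x \<partial>lborel)"
        by simp
      then have "\<bar>W (v + s *\<^sub>R axis j 1) - W v - 2 * s * ?J\<bar> / \<bar>s\<bar> \<le> 2 * s\<^sup>2 * (\<integral>x. M x \<partial>lborel) / \<bar>s\<bar>"
        by (rule divide_right_mono) simp
      also have "2 * s\<^sup>2 * (\<integral>x. M x \<partial>lborel) / \<bar>s\<bar> = 2 * \<bar>s\<bar> * (\<integral>x. M x \<partial>lborel)"
        using s(1) by (simp add: field_simps power2_eq_square flip: abs_mult)
      also have "\<bar>W (v + s *\<^sub>R axis j 1) - W v - 2 * s * ?J\<bar> / \<bar>s\<bar> = norm ((W (v + s *\<^sub>R axis j 1) - W v) / s - 2 * ?J)"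
        using s(1) by (simp add: diff_divide_distrib flip: abs_divide)
      finally show "norm ((W (v + s *\<^sub>R axis j 1) - W v) / s - 2 * ?J) \<le> 2 * \<bar>s\<bar> * (\<integral>x. M x \<partial>lborel)" .
    qed
  qed
  then have "((\<lambda>s. W (v + s *\<^sub>R axis j 1)) has_real_derivative 2 * ?J) (at 0)"
    unfolding DERIV_def by (subst LIM_zero_iff[symmetric]) simp
  then show "partial j W v = 2 * ?J"
    unfolding partial_def by (rule DERIV_imp_deriv)
qed

section \<open>The Hessian of the squared distance\<close>

lemma DERIV_g:
  assumes x: "x \<in> X" and v: "v + s *\<^sub>R axis i 1 \<in> \<Theta>"
    and part: "has_partial i (\<lambda>v. q (F v x)) (v + s *\<^sub>R axis i 1)"
  defines "w \<equiv> v + s *\<^sub>R axis i 1"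
  shows "((\<lambda>s. g j (v + s *\<^sub>R axis i 1) x) has_real_derivative
    (q (F w x) - x) * partial i (partial j (\<lambda>v. F v x)) w
      + partial i (\<lambda>v. q (F v x)) w * partial j (\<lambda>v. F v x) w) (at s)"
proof -
  have "((\<lambda>s. q (F (v + s *\<^sub>R axis i 1) x)) has_real_derivative partial i (\<lambda>v. q (F v x)) w) (at s)"
    unfolding w_def by (rule has_partial_DERIV[OF part])
  moreover have "((\<lambda>s. partial j (\<lambda>v. F v x) (v + s *\<^sub>R axis i 1)) has_real_derivative
      partial i (partial j (\<lambda>v. F v x)) w) (at s)"
    unfolding w_def by (intro has_partial_DERIV differentiable_imp_has_partial F_differentiable x v)
  ultimately show ?thesis
    unfolding g_def w_def by (auto intro!: derivative_eq_intros)
qed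

text \<open>For almost every \<open>x\<close>, row \<open>j\<close> of \<open>C\<close> is the
  gradient of \<open>g j\<close> at \<open>t\<^sub>0\<close>, and (ii) supplies the domination for
  differentiating the formula of \<open>partial_W\<close> once more. The two terms of
  \<open>C\<close> stay together because (ii) bounds them only jointly.\<close>

lemma has_hessian_W:
  fixes t\<^sub>0 :: "real^'d"
  assumes t0: "t\<^sub>0 \<in> \<Theta>" and W_diff: "\<And>v. v \<in> \<Theta> \<Longrightarrow> W differentiable (at v)" and \<eta>: "\<eta> > 0"
    and part: "\<And>x v i. x \<in> X \<Longrightarrow> v \<in> \<Theta> \<inter> cball t\<^sub>0 \<eta> \<Longrightarrow> has_partial i (\<lambda>v. q (F v x)) v"
    and fin: "\<And>i j. (\<integral>\<^sup>+x\<in>X. (SUP v\<in>\<Theta> \<inter> cball t\<^sub>0 \<eta>. ennreal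
        \<bar>(q (F v x) - x) * partial i (partial j (\<lambda>v. F v x)) v
          + partial i (\<lambda>v. q (F v x)) v * partial j (\<lambda>v. F v x) v\<bar>) \<partial>lebesgue) < \<infinity>"
  defines "C \<equiv> \<lambda>x. (q (F t\<^sub>0 x) - x) *\<^sub>R hess (\<lambda>v. F v x) t\<^sub>0 +
      deriv (\<lambda>x. q (F t\<^sub>0 x)) x *\<^sub>R ((1 / p t\<^sub>0 x) *\<^sub>R outer (grad (\<lambda>v. F v x) t\<^sub>0))"
  shows "set_integrable lebesgue X C" and "has_hessian W (2 *\<^sub>R (LINT x:X|lebesgue. C x)) t\<^sub>0"
proof -
  interpret t0: positive_density a b "p t\<^sub>0" "P t\<^sub>0" by (rule density[OF t0])
  obtain r0 where r0: "r0 > 0" "ball t\<^sub>0 r0 \<subseteq> \<Theta>" using open_\<Theta> t0 openE by blast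
  \<comment> \<open>The resulting open ball is convex and lies both in \<open>\<Theta>\<close> and
    in the region where (ii) gives control.\<close>
  define r where "r = min r0 \<eta>"
  have r: "r > 0" "ball t\<^sub>0 r \<subseteq> \<Theta>" "ball t\<^sub>0 r \<subseteq> \<Theta> \<inter> cball t\<^sub>0 \<eta>"
    using r0 \<eta> by (auto simp: r_def subset_iff)
  define g' where "g' = (\<lambda>i j v x. (q (F v x) - x) * partial i (partial j (\<lambda>v. F v x)) v
          + partial i (\<lambda>v. q (F v x)) v * partial j (\<lambda>v. F v x) v)"
  have DERIV: "((\<lambda>s. g j (v + s *\<^sub>R axis i 1) x) has_real_derivative g' i j (v + s *\<^sub>R axis i 1) x) (at s)"
    if "x \<in> X" "v + s *\<^sub>R axis i 1 \<in> ball t\<^sub>0 r" for v s x i j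
    unfolding g'_def using that r(2,3) by (intro DERIV_g part) auto
  \<comment> \<open>Bundles the properties of a dominating function, so that one choice produces
    \<open>M i j\<close> for all pairs of indices.\<close>
  define is_bound where "is_bound = (\<lambda>i j M. integrable lborel M \<and> (\<forall>x. 0 \<le> M x) \<and>
    (AE x in lborel. x \<in> X \<longrightarrow> (\<forall>v s. v \<in> ball t\<^sub>0 r \<longrightarrow> v + s *\<^sub>R axis i 1 \<in> ball t\<^sub>0 r \<longrightarrow>
      \<bar>g j (v + s *\<^sub>R axis i 1) x - g j v x\<bar> \<le> \<bar>s\<bar> * M x)))"
  have ex_bound: "\<exists>M. is_bound i j M" for i j
  proof -
    \<comment> \<open>Shrinking the index set lowers the supremum. The nonnegative integral has the
      same value for the completed measure, also for a possibly non-measurable supremum.\<close>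
    have "(\<integral>\<^sup>+x\<in>X. (SUP v\<in>ball t\<^sub>0 r. ennreal \<bar>g' i j v x\<bar>) \<partial>lborel) \<le>
        (\<integral>\<^sup>+x\<in>X. (SUP v\<in>\<Theta> \<inter> cball t\<^sub>0 \<eta>. ennreal \<bar>g' i j v x\<bar>) \<partial>lborel)"
      using r(3) by (intro nn_integral_mono mult_right_mono SUP_subset_mono) auto
    also have "\<dots> < \<infinity>"
      using fin[of i j] by (simp add: g'_def nn_integral_completion)
    finally have fin': "(\<integral>\<^sup>+x\<in>X. (SUP v\<in>ball t\<^sub>0 r. ennreal \<bar>g' i j v x\<bar>) \<partial>lborel) < \<infinity>" .
    have cont: "continuous_on (ball t\<^sub>0 r) (\<lambda>v. g j v x)" if "x \<in> X" for x
      using r(2) that by (intro continuous_at_imp_continuous_on ballI isCont_g) auto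
    have meas: "(\<lambda>x. indicator X x * g j v x) \<in> borel_measurable borel" if "v \<in> ball t\<^sub>0 r" for v
      using r(2) that by (intro measurable_g) auto
    show ?thesis
      unfolding is_bound_def
      by (rule obtain_integrable_lipschitz_constant[OF borel_einterval convex_ball cont meas DERIV fin']) blast+
  qed
  define M where "M = (\<lambda>i j. SOME M. is_bound i j M)"
  have "is_bound i j (M i j)" for i j
    unfolding M_def by (rule someI_ex[OF ex_bound])
  then have M: "integrable lborel (M i j)" "0 \<le> M i j x"
    "AE x in lborel. x \<in> X \<longrightarrow> (\<forall>v s. v \<in> ball t\<^sub>0 r \<longrightarrow> v + s *\<^sub>R axis i 1 \<in> ball t\<^sub>0 r \<longrightarrow>
      \<bar>g j (v + s *\<^sub>R axis i 1) x - g j v x\<bar> \<le> \<bar>s\<bar> * M i j x)" for i j x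
    unfolding is_bound_def by simp_all
  define gX where "gX = (\<lambda>j v x. indicator X x * g j v x)"
  have int_gX: "integrable lborel (gX j v)" and partial_gX: "partial j W v = 2 * (\<integral>x. gX j v x \<partial>lborel)"
    if "v \<in> ball t\<^sub>0 r" for j v
    unfolding gX_def using partial_W[OF r(2) M that] by auto
  have gX_meas: "gX j v \<in> borel_measurable lborel" if "v \<in> ball t\<^sub>0 r" for j v
    using int_gX[OF that] by simp
  \<comment> \<open>At almost every \<open>x\<close> the distribution function has derivative
    \<open>p t\<^sub>0 x\<close>, which cancels the factor \<open>1 / p t\<^sub>0 x\<close> in
    \<open>C\<close>. The first index of \<open>C\<close> belongs to \<open>g j\<close>, the second
    to the direction of differentiation.\<close>
  have "AE x in lborel. x \<in> X \<longrightarrow> (\<forall>i. g' i j t\<^sub>0 x = C x $ j $ i) \<and> ((\<lambda>v. g j v x) has_derivative (\<lambda>h. h \<bullet> C x $ j)) (at t\<^sub>0)" for j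
    using AE_DERIV_indefinite_integral[OF t0.integrable_density]
  proof (eventually_elim, intro impI)
    fix x assume "((\<lambda>x. LBINT y:{..x}. p t\<^sub>0 y) has_real_derivative p t\<^sub>0 x) (at x)" and x: "x \<in> X"
    then have DF: "(F t\<^sub>0 has_real_derivative p t\<^sub>0 x) (at x)"
      by (simp add: F[abs_def])
    obtain A where A: "has_hessian (\<lambda>v. F v x) A t\<^sub>0"
      using F_hess[OF t0 x] by (auto simp: twice_differentiable_at_def)
    have part': "has_partial i (\<lambda>v. q (F v x)) t\<^sub>0" for i
      using part[OF x] t0 \<eta> by auto
    have p: "p t\<^sub>0 x > 0" by (rule t0.pos[OF x])
    have "deriv (\<lambda>x. q (F t\<^sub>0 x)) x * (partial i (\<lambda>v. F v x) t\<^sub>0 * partial j (\<lambda>v. F v x) t\<^sub>0) =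
        p t\<^sub>0 x * (partial i (\<lambda>v. q (F v x)) t\<^sub>0 * partial j (\<lambda>v. F v x) t\<^sub>0)" for i
      by (rule deriv_compose_mult_partial[OF A part' DF refl])
    then have Cji: "C x $ j $ i = (q (F t\<^sub>0 x) - x) * A $ j $ i + partial i (\<lambda>v. q (F v x)) t\<^sub>0 * partial j (\<lambda>v. F v x) t\<^sub>0" for i
      using p by (simp add: C_def has_hessian_imp_hess_eq[OF A] outer_def grad_def field_simps)
    have "partial i (partial j (\<lambda>v. F v x)) t\<^sub>0 = A $ j $ i" for i
      using has_hessian_imp_hess_eq[OF A] has_hessian_symmetric[OF A, of i j] by (simp add: hess_def vec_eq_iff)
    then have "g' i j t\<^sub>0 x = C x $ j $ i" for i
      unfolding Cji g'_def by simp
    moreover have "C x $ j = (q (F t\<^sub>0 x) - x) *\<^sub>R A $ j + partial j (\<lambda>v. F v x) t\<^sub>0 *\<^sub>R grad (\<lambda>v. q (F v x)) t\<^sub>0"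
      by (simp add: vec_eq_iff Cji grad_def)
    then have "((\<lambda>v. g j v x) has_derivative (\<lambda>h. h \<bullet> C x $ j)) (at t\<^sub>0)"
      using has_derivative_compose_mult_partial[OF A isCont_q[OF F_bounds[OF t0 x]] part', of x]
      by (simp add: g_def)
    ultimately show "(\<forall>i. g' i j t\<^sub>0 x = C x $ j $ i) \<and> ((\<lambda>v. g j v x) has_derivative (\<lambda>h. h \<bullet> C x $ j)) (at t\<^sub>0)"
      by blast
  qed
  then have C: "AE x in lebesgue. x \<in> X \<longrightarrow> (\<forall>i. g' i j t\<^sub>0 x = C x $ j $ i) \<and> ((\<lambda>v. g j v x) has_derivative (\<lambda>h. h \<bullet> C x $ j)) (at t\<^sub>0)" for j
    by (rule AE_completion)
  define CX where "CX = (\<lambda>x. indicator X x *\<^sub>R C x)"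
  have row: "integrable lebesgue (\<lambda>x. CX x $ j)"
    "((\<lambda>v. \<integral>x. gX j v x \<partial>lebesgue) has_derivative (\<lambda>h. h \<bullet> (\<integral>x. CX x $ j \<partial>lebesgue))) (at t\<^sub>0)" for j
  proof -
    have "(\<lambda>x. \<chi> i. indicator X x * g' i j t\<^sub>0 x) \<in> borel_measurable lebesgue"
    proof (rule borel_measurable_euclidean_space[THEN iffD2], intro ballI)
      fix b :: "real^'d" assume "b \<in> Basis"
      then obtain i where b: "b = axis i 1" by (auto simp: Basis_vec_def)
      have "(\<lambda>x. indicator X x * partial i (\<lambda>v. g j v x) t\<^sub>0) \<in> borel_measurable borel"
      proof (rule borel_measurable_partial[OF open_\<Theta> t0])
        show "has_partial i (\<lambda>v. g j v x) t\<^sub>0" if "x \<in> X" for x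
          using DERIV[OF that, of t\<^sub>0 0 i j] r(1) by (auto simp: has_partial_def real_differentiable_def)
      qed (rule measurable_g)
      also have "(\<lambda>x. indicator X x * partial i (\<lambda>v. g j v x) t\<^sub>0) = (\<lambda>x. indicator X x * g' i j t\<^sub>0 x)"
        using DERIV[of _ t\<^sub>0 0 i j] r(1) by (auto simp: partial_def indicator_def fun_eq_iff intro!: DERIV_imp_deriv)
      finally have "(\<lambda>x. indicator X x * g' i j t\<^sub>0 x) \<in> borel_measurable lebesgue"
        by (intro measurable_completion) simp
      then show "(\<lambda>x. (\<chi> i. indicator X x * g' i j t\<^sub>0 x) \<bullet> b) \<in> borel_measurable lebesgue"
        by (simp add: b inner_axis)
    qed
    \<comment> \<open>\<open>C\<close> contains a derivative in \<open>x\<close>; its measurability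
      is inherited, in the complete measure, from the almost everywhere equal
      \<open>g'\<close>.\<close>
    then have CX_meas: "(\<lambda>x. CX x $ j) \<in> borel_measurable lebesgue"
      by (rule borel_measurable_AE)
        (use C[of j] in \<open>auto elim!: eventually_mono simp: CX_def vec_eq_iff indicator_def\<close>)
    have 1: "integrable lebesgue (gX j v)" if "v \<in> ball t\<^sub>0 r" for v
      using int_gX[OF that] gX_meas[OF that] by (simp add: integrable_completion)
    have 2: "AE x in lebesgue. ((\<lambda>v. gX j v x) has_derivative (\<lambda>h. h \<bullet> CX x $ j)) (at t\<^sub>0)"
      using C[of j]
    proof eventually_elim
      case (elim x)
      then show ?case by (cases "x \<in> X") (simp_all add: gX_def CX_def)
    qed
    have 3: "integrable lebesgue (\<lambda>x. \<Sum>i\<in>UNIV. M i j x)"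
      using M(1) by (intro Bochner_Integration.integrable_sum) (simp add: integrable_completion)
    \<comment> \<open>The exceptional null sets of the finitely many directions are merged, so that
      the coordinatewise path may use all bounds at one \<open>x\<close>.\<close>
    have "AE x in lborel. \<forall>i. x \<in> X \<longrightarrow> (\<forall>v s. v \<in> ball t\<^sub>0 r \<longrightarrow>
      v + s *\<^sub>R axis i 1 \<in> ball t\<^sub>0 r \<longrightarrow> \<bar>g j (v + s *\<^sub>R axis i 1) x - g j v x\<bar> \<le> \<bar>s\<bar> * M i j x)"
      unfolding AE_all_countable using M(3) by blast
    then have "AE x in lborel. \<forall>v\<in>ball t\<^sub>0 r. \<bar>gX j v x - gX j t\<^sub>0 x\<bar> \<le> norm (v - t\<^sub>0) * (\<Sum>i\<in>UNIV. M i j x)"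
    proof (eventually_elim, intro ballI)
      fix x v assume *: "\<forall>i. x \<in> X \<longrightarrow> (\<forall>v s. v \<in> ball t\<^sub>0 r \<longrightarrow>
        v + s *\<^sub>R axis i 1 \<in> ball t\<^sub>0 r \<longrightarrow> \<bar>g j (v + s *\<^sub>R axis i 1) x - g j v x\<bar> \<le> \<bar>s\<bar> * M i j x)"
        and v: "v \<in> ball t\<^sub>0 r"
      show "\<bar>gX j v x - gX j t\<^sub>0 x\<bar> \<le> norm (v - t\<^sub>0) * (\<Sum>i\<in>UNIV. M i j x)"
      proof (cases "x \<in> X")
        case True
        then have "\<bar>g j v x - g j t\<^sub>0 x\<bar> \<le> norm (v - t\<^sub>0) * (\<Sum>i\<in>UNIV. M i j x)"
          using * M(2) by (intro abs_diff_le_coordinatewise[OF v]) auto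
        then show ?thesis using True by (simp add: gX_def)
      next
        case False
        then show ?thesis using M(2) by (simp add: gX_def sum_nonneg)
      qed
    qed
    then have 4: "AE x in lebesgue. \<forall>v\<in>ball t\<^sub>0 r. \<bar>gX j v x - gX j t\<^sub>0 x\<bar> \<le> norm (v - t\<^sub>0) * (\<Sum>i\<in>UNIV. M i j x)"
      by (rule AE_completion)
    show "integrable lebesgue (\<lambda>x. CX x $ j)"
      "((\<lambda>v. \<integral>x. gX j v x \<partial>lebesgue) has_derivative (\<lambda>h. h \<bullet> (\<integral>x. CX x $ j \<partial>lebesgue))) (at t\<^sub>0)"
      using has_derivative_integral_dominated[OF r(1) 1 2 CX_meas 3 4] by auto
  qed
  have int_CX: "integrable lebesgue CX"
    using row(1) by (rule integrable_vecI)
  then show "set_integrable lebesgue X C"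
    by (simp add: set_integrable_def CX_def)
  let ?I = "\<integral>x. CX x \<partial>lebesgue"
  have I: "(LINT x:X|lebesgue. C x) = ?I" by (simp add: set_lebesgue_integral_def CX_def)
  \<comment> \<open>The rows are assembled into a matrix: component \<open>j\<close> of the gradient
    has derivative \<open>h \<bullet> row j\<close>.\<close>
  have "((\<lambda>v. \<chi> j. 2 * (\<integral>x. gX j v x \<partial>lebesgue)) has_derivative (\<lambda>h. (2 *\<^sub>R ?I) *v h)) (at t\<^sub>0)"
  proof (subst has_derivative_componentwise_within, intro ballI)
    fix b :: "real^'d" assume "b \<in> Basis"
    then obtain j where b: "b = axis j 1" by (auto simp: Basis_vec_def)
    have "((\<lambda>v. 2 * (\<integral>x. gX j v x \<partial>lebesgue)) has_derivative (\<lambda>h. 2 * (h \<bullet> (\<integral>x. CX x $ j \<partial>lebesgue)))) (at t\<^sub>0)"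
      by (intro has_derivative_mult_right row(2))
    then show "((\<lambda>v. (\<chi> j. 2 * (\<integral>x. gX j v x \<partial>lebesgue)) \<bullet> b) has_derivative (\<lambda>h. ((2 *\<^sub>R ?I) *v h) \<bullet> b)) (at t\<^sub>0)"
      by (simp add: b inner_axis matrix_vector_mul_component integral_vec_nth[OF int_CX] inner_commute[of "integral\<^sup>L lebesgue _"])
  qed
  then have "(grad W has_derivative (\<lambda>h. (2 *\<^sub>R ?I) *v h)) (at t\<^sub>0)"
  proof (rule has_derivative_transform_within_open)
    show "open (ball t\<^sub>0 r)" "t\<^sub>0 \<in> ball t\<^sub>0 r" using r by auto
    show "(\<chi> j. 2 * (\<integral>x. gX j v x \<partial>lebesgue)) = grad W v" if "v \<in> ball t\<^sub>0 r" for v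
      using partial_gX[OF that] gX_meas[OF that] by (simp add: grad_def vec_eq_iff integral_completion)
  qed
  \<comment> \<open>Total differentiability of \<open>W\<close> near \<open>t\<^sub>0\<close> comes
    from the hypothesis; \<open>partial_W\<close> computes partial derivatives.\<close>
  moreover have "\<forall>\<^sub>F s in nhds t\<^sub>0. W differentiable (at s)"
    using eventually_nhds_in_open[OF open_\<Theta> t0] by eventually_elim (rule W_diff)
  ultimately show "has_hessian W (2 *\<^sub>R (LINT x:X|lebesgue. C x)) t\<^sub>0"
    by (simp add: has_hessian_def I)
qed

end

text \<open>Condition (ii) dominates the two integrands only as a sum, so the formula is given for
  the integral of the sum. As soon as one summand is integrable, the other is too by subtraction,
  and the integral splits.\<close>

theorem theorem5:
  fixes a b :: ereal
    and \<Theta> :: "(real^'d::finite) set"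
    and P :: "real^'d \<Rightarrow> real measure"
    and p F :: "real^'d \<Rightarrow> real \<Rightarrow> real"
    and T :: "real^'d \<Rightarrow> real^'d \<Rightarrow> real \<Rightarrow> real"
    and t\<^sub>0 :: "real^'d"
    and X :: "real set"
  assumes "a < b"
    and X: "X = einterval a b"
    and "open \<Theta>"
    and "\<And>\<theta>. \<theta> \<in> \<Theta> \<Longrightarrow> p \<theta> \<in> borel_measurable borel"
    and "\<And>\<theta>. \<theta> \<in> \<Theta> \<Longrightarrow> P \<theta> = density lborel (\<lambda>x. ennreal (p \<theta> x))"
    and "\<And>\<theta>. \<theta> \<in> \<Theta> \<Longrightarrow> prob_space (P \<theta>)"
    and "\<And>\<theta>. \<theta> \<in> \<Theta> \<Longrightarrow> integrable (P \<theta>) (\<lambda>x. x\<^sup>2)"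
    and "\<And>\<theta> x. \<theta> \<in> \<Theta> \<Longrightarrow> x \<in> X \<Longrightarrow> p \<theta> x > 0"
    and "\<And>\<theta> x. \<theta> \<in> \<Theta> \<Longrightarrow> x \<notin> X \<Longrightarrow> p \<theta> x = 0"
    and F: "\<And>\<theta> x. F \<theta> x = (LBINT y:{..x}. p \<theta> y)"
    and T: "\<And>t \<theta> x. T t \<theta> x = quantile (F \<theta>) (F t x)"
    and "t\<^sub>0 \<in> \<Theta>"
    and i_diff: "\<And>\<theta> x. \<theta> \<in> \<Theta> \<Longrightarrow> x \<in> X \<Longrightarrow> (\<lambda>v. p v x) differentiable (at \<theta>)"
    and i_int: "\<exists>\<delta>>0. \<forall>i.
        (\<integral>\<^sup>+x\<in>X. (SUP v\<in>\<Theta> \<inter> cball t\<^sub>0 \<delta>. ennreal \<bar>partial i (\<lambda>v. p v x) v\<bar>) \<partial>lebesgue) < \<infinity>"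
    and ii_diff: "\<And>\<theta> x. \<theta> \<in> \<Theta> \<Longrightarrow> x \<in> X \<Longrightarrow> twice_differentiable_at (\<lambda>v. F v x) \<theta>"
    and ii_int: "\<And>\<theta>. \<theta> \<in> \<Theta> \<Longrightarrow> \<exists>\<eta>>0.
        (\<forall>x\<in>X. \<forall>v\<in>\<Theta> \<inter> cball t\<^sub>0 \<eta>. \<forall>i. has_partial i (\<lambda>v. T v \<theta> x) v) \<and>
        (\<forall>i j. (\<integral>\<^sup>+x\<in>X. (SUP v\<in>\<Theta> \<inter> cball t\<^sub>0 \<eta>. ennreal
            \<bar>(T v \<theta> x - x) * partial i (partial j (\<lambda>v. F v x)) v
              + partial i (\<lambda>v. T v \<theta> x) v * partial j (\<lambda>v. F v x) v\<bar>) \<partial>lebesgue) < \<infinity>)"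
    and iii_a: "\<And>\<theta> x\<^sub>0. \<theta> \<in> \<Theta> \<Longrightarrow> x\<^sub>0 \<in> X \<Longrightarrow>
        (((\<lambda>x. (LBINT y=x\<^sub>0..x. y - T t\<^sub>0 \<theta> y) *\<^sub>R grad (\<lambda>t. F t x) t\<^sub>0) \<circ> real_of_ereal)
          \<longlongrightarrow> 0) (at_right a)"
    and iii_b: "\<And>\<theta> x\<^sub>0. \<theta> \<in> \<Theta> \<Longrightarrow> x\<^sub>0 \<in> X \<Longrightarrow>
        (((\<lambda>x. (LBINT y=x\<^sub>0..x. y - T t\<^sub>0 \<theta> y) *\<^sub>R grad (\<lambda>t. F t x) t\<^sub>0) \<circ> real_of_ereal)
          \<longlongrightarrow> 0) (at_left b)"
    and W_diff: "\<And>\<theta> t. \<theta> \<in> \<Theta> \<Longrightarrow> t \<in> \<Theta> \<Longrightarrow> (\<lambda>t. W2_sq (P t) (P \<theta>)) differentiable (at t)"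
    and W_grad: "\<And>\<theta> \<phi>. \<theta> \<in> \<Theta> \<Longrightarrow> \<phi> \<in> potentials X (P t\<^sub>0) (P \<theta>) \<Longrightarrow>
        set_integrable lebesgue X (\<lambda>x. \<phi> x *\<^sub>R grad (\<lambda>t. p t x) t\<^sub>0) \<and>
        grad (\<lambda>t. W2_sq (P t) (P \<theta>)) t\<^sub>0 =
          (LINT x:X|lebesgue. \<phi> x *\<^sub>R grad (\<lambda>t. p t x) t\<^sub>0)"
  shows "\<forall>\<theta>\<in>\<Theta>.
    (let W = (\<lambda>t. W2_sq (P t) (P \<theta>));
         A = (\<lambda>x. (T t\<^sub>0 \<theta> x - x) *\<^sub>R hess (\<lambda>t. F t x) t\<^sub>0);
         B = (\<lambda>x. deriv (T t\<^sub>0 \<theta>) x *\<^sub>R ((1 / p t\<^sub>0 x) *\<^sub>R outer (grad (\<lambda>t. F t x) t\<^sub>0)))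
     in set_integrable lebesgue X (\<lambda>x. A x + B x) \<and>
        has_hessian W (2 *\<^sub>R (LINT x:X|lebesgue. A x + B x)) t\<^sub>0 \<and>
        (set_integrable lebesgue X A \<or> set_integrable lebesgue X B \<longrightarrow>
           set_integrable lebesgue X A \<and> set_integrable lebesgue X B \<and>
           has_hessian W (2 *\<^sub>R ((LINT x:X|lebesgue. A x) + (LINT x:X|lebesgue. B x))) t\<^sub>0))"
proof
  fix \<theta> assume \<theta>: "\<theta> \<in> \<Theta>"
  have T_eq: "T = (\<lambda>t \<theta> x. quantile (F \<theta>) (F t x))"
    by (simp add: T fun_eq_iff)
  interpret fam: density_family a b \<Theta> P p F \<theta>
  proof (rule density_family.intro)
    show "positive_density a b (p v) (P v)" if "v \<in> \<Theta>" for v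
      using assms(4-6,8,9)[OF that] by (intro positive_density.intro) (simp_all add: X)
  qed (use \<open>open \<Theta>\<close> \<theta> assms(7) F ii_diff in \<open>simp_all add: X\<close>)
  obtain \<eta> where \<eta>: "\<eta> > 0"
    and part: "\<And>x v i. x \<in> X \<Longrightarrow> v \<in> \<Theta> \<inter> cball t\<^sub>0 \<eta> \<Longrightarrow> has_partial i (\<lambda>v. T v \<theta> x) v"
    and fin: "\<And>i j. (\<integral>\<^sup>+x\<in>X. (SUP v\<in>\<Theta> \<inter> cball t\<^sub>0 \<eta>. ennreal
        \<bar>(T v \<theta> x - x) * partial i (partial j (\<lambda>v. F v x)) v
          + partial i (\<lambda>v. T v \<theta> x) v * partial j (\<lambda>v. F v x) v\<bar>) \<partial>lebesgue) < \<infinity>"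
    using ii_int[OF \<theta>] by blast
  let ?W = "\<lambda>t. W2_sq (P t) (P \<theta>)"
  define A where "A = (\<lambda>x. (T t\<^sub>0 \<theta> x - x) *\<^sub>R hess (\<lambda>t. F t x) t\<^sub>0)"
  define B where "B = (\<lambda>x. deriv (T t\<^sub>0 \<theta>) x *\<^sub>R ((1 / p t\<^sub>0 x) *\<^sub>R outer (grad (\<lambda>t. F t x) t\<^sub>0)))"
  note result = fam.has_hessian_W[OF \<open>t\<^sub>0 \<in> \<Theta>\<close> W_diff[OF \<theta>] \<eta>
      part[unfolded T_eq X] fin[unfolded T_eq X], folded X]
  have int_AB: "set_integrable lebesgue X (\<lambda>x. A x + B x)"
    and hess_AB: "has_hessian ?W (2 *\<^sub>R (LINT x:X|lebesgue. A x + B x)) t\<^sub>0"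
    using result unfolding A_def B_def T_eq by blast+
  have both: "set_integrable lebesgue X A \<and> set_integrable lebesgue X B"
    if "set_integrable lebesgue X A \<or> set_integrable lebesgue X B"
    using that set_integral_diff(1)[OF int_AB, of A] set_integral_diff(1)[OF int_AB, of B] by auto
  have "set_integrable lebesgue X A \<or> set_integrable lebesgue X B \<longrightarrow>
      set_integrable lebesgue X A \<and> set_integrable lebesgue X B \<and>
      has_hessian ?W (2 *\<^sub>R ((LINT x:X|lebesgue. A x) + (LINT x:X|lebesgue. B x))) t\<^sub>0"
    using both hess_AB by (auto simp: set_integral_add(2))
  with int_AB hess_AB
  show "let W = ?W;
         A = (\<lambda>x. (T t\<^sub>0 \<theta> x - x) *\<^sub>R hess (\<lambda>t. F t x) t\<^sub>0);
         B = (\<lambda>x. deriv (T t\<^sub>0 \<theta>) x *\<^sub>R ((1 / p t\<^sub>0 x) *\<^sub>R outer (grad (\<lambda>t. F t x) t\<^sub>0)))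
     in set_integrable lebesgue X (\<lambda>x. A x + B x) \<and>
        has_hessian W (2 *\<^sub>R (LINT x:X|lebesgue. A x + B x)) t\<^sub>0 \<and>
        (set_integrable lebesgue X A \<or> set_integrable lebesgue X B \<longrightarrow>
           set_integrable lebesgue X A \<and> set_integrable lebesgue X B \<and>
           has_hessian W (2 *\<^sub>R ((LINT x:X|lebesgue. A x) + (LINT x:X|lebesgue. B x))) t\<^sub>0)"
    unfolding Let_def A_def B_def by blast
qed

end
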